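(* Let $P$ and $P'$ be smooth $3$-dimensional prismatoids in $\mathbb{R}^3$ which are Minkowski equivalent. Then the pair $(P, P')$ is IDP, i.e. every lattice point of $P + P'$ is the sum of a lattice point of $P$ and a lattice point of $P'$.
   Context: A lattice polytope is the convex hull of finitely many points of $\mathbb{Z}^d$. A $d$-dimensional polytope is simple if each vertex lies in exactly $d$ edges. The primitive edge directions at a vertex are the smallest lattice vectors pointing along its incident edges. A $d$-dimensional lattice polytope in $\mathbb{R}^d$ is smooth if it is simple and at every vertex the primitive edge directions form a basis of $\mathbb{Z}^d$. A $d$-dimensional prism is a polytope affinely equivalent to $Q \times [0,1]$ for some $(d-1)$-dimensional polytope $Q$; its top and bottom facets are the images of $Q\times\{1\}$ and $Q \times \{0\}$. A prismatoid is a polytope whose face lattice is isomorphic to that of a prism and such that the facets corresponding to the top and bottom facets (called its top and bottom) are parallel. Two faces $F,G$ are parallel if $\mathrm{lin}(F)=\mathrm{lin}(G)$, where $\mathrm{lin}(F)$ is the linear subspace parallel to the affine hull of $F$. Two polytopes are Minkowski equivalent if they have the same normal fan. For lattice polytopes $P,Q$, the pair $(P,Q)$ is IDP if every lattice point of $P+Q$ is the sum of a lattice point of $P$ and a lattice point of $Q$. *)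

theory Defs
  imports "HOL-Analysis.Analysis"
begin

definition lattice_pt :: "real^3 \<Rightarrow> bool" where
  "lattice_pt x \<longleftrightarrow> (\<forall>i. x $ i \<in> \<int>)"

definition lattice_polytope :: "(real^3) set \<Rightarrow> bool" where
  "lattice_polytope P \<longleftrightarrow> (\<exists>V. finite V \<and> (\<forall>v\<in>V. lattice_pt v) \<and> P = convex hull V)"

definition prim_edge_dir :: "real^3 \<Rightarrow> (real^3) set \<Rightarrow> real^3 \<Rightarrow> bool" where
  "prim_edge_dir v E u \<longleftrightarrow>
     lattice_pt u \<and> u \<noteq> 0 \<and> (\<exists>t>0. v + t *\<^sub>R u \<in> E) \<and>
     (\<forall>u'. lattice_pt u' \<and> u' \<noteq> 0 \<and> (\<exists>t>0. v + t *\<^sub>R u' \<in> E) \<longrightarrow> norm u \<le> norm u')"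

definition prim_edge_dirs :: "(real^3) set \<Rightarrow> real^3 \<Rightarrow> (real^3) set" where
  "prim_edge_dirs P v = {u. \<exists>E. E edge_of P \<and> v \<in> E \<and> prim_edge_dir v E u}"

definition lattice_basis :: "(real^3) set \<Rightarrow> bool" where
  "lattice_basis U \<longleftrightarrow> (\<forall>u\<in>U. lattice_pt u) \<and> independent U \<and>
     (\<forall>x. lattice_pt x \<longrightarrow> (\<exists>c. (\<forall>u\<in>U. c u \<in> \<int>) \<and> x = (\<Sum>u\<in>U. c u *\<^sub>R u)))"

definition simple_polytope3 :: "(real^3) set \<Rightarrow> bool" where
  "simple_polytope3 P \<longleftrightarrow> polytope P \<and> aff_dim P = 3 \<and>
     (\<forall>v. v extreme_point_of P \<longrightarrow> card {E. E edge_of P \<and> v \<in> E} = 3)"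

definition smooth_polytope3 :: "(real^3) set \<Rightarrow> bool" where
  "smooth_polytope3 P \<longleftrightarrow> lattice_polytope P \<and> simple_polytope3 P \<and>
     (\<forall>v. v extreme_point_of P \<longrightarrow> lattice_basis (prim_edge_dirs P v))"

definition lin_space :: "(real^3) set \<Rightarrow> (real^3) set" where
  "lin_space F = span {x - y | x y. x \<in> F \<and> y \<in> F}"

definition std_prism :: "(real^3) set \<Rightarrow> (real^3) set" where
  "std_prism Q = {q + t *\<^sub>R axis 3 1 | q t. q \<in> Q \<and> 0 \<le> t \<and> t \<le> 1}"

definition std_top :: "(real^3) set \<Rightarrow> (real^3) set" where
  "std_top Q = (\<lambda>q. q + axis 3 1) ` Q"

definition base_ok :: "(real^3) set \<Rightarrow> bool" where
  "base_ok Q \<longleftrightarrow> polytope Q \<and> aff_dim Q = 2 \<and> (\<forall>q\<in>Q. q $ 3 = 0)"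

text \<open>Face lattice isomorphism (faces include the empty face and the polytope itself).\<close>
definition face_lattice_iso :: "((real^3) set \<Rightarrow> (real^3) set) \<Rightarrow> (real^3) set \<Rightarrow> (real^3) set \<Rightarrow> bool" where
  "face_lattice_iso \<phi> A B \<longleftrightarrow>
     bij_betw \<phi> {F. F face_of A} {G. G face_of B} \<and>
     (\<forall>F1 F2. F1 face_of A \<longrightarrow> F2 face_of A \<longrightarrow> (F1 \<subseteq> F2 \<longleftrightarrow> \<phi> F1 \<subseteq> \<phi> F2))"

definition prismatoid3 :: "(real^3) set \<Rightarrow> bool" where
  "prismatoid3 P \<longleftrightarrow> polytope P \<and>
     (\<exists>Q g b \<phi>. base_ok Q \<and> linear g \<and> bij g \<and>
        (let f = (\<lambda>x. g x + b) in
          face_lattice_iso \<phi> (f ` std_prism Q) P \<and>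
          lin_space (\<phi> (f ` std_top Q)) = lin_space (\<phi> (f ` Q))))"

definition normal_cone :: "(real^3) set \<Rightarrow> (real^3) set \<Rightarrow> (real^3) set" where
  "normal_cone P F = {c. \<forall>x\<in>F. \<forall>y\<in>P. c \<bullet> y \<le> c \<bullet> x}"

definition normal_fan :: "(real^3) set \<Rightarrow> (real^3) set set" where
  "normal_fan P = {normal_cone P F | F. F face_of P \<and> F \<noteq> {}}"

definition minkowski_equiv :: "(real^3) set \<Rightarrow> (real^3) set \<Rightarrow> bool" where
  "minkowski_equiv P Q \<longleftrightarrow> normal_fan P = normal_fan Q"

definition IDP_pair :: "(real^3) set \<Rightarrow> (real^3) set \<Rightarrow> bool" where
  "IDP_pair P Q \<longleftrightarrow> (\<forall>z. lattice_pt z \<and> z \<in> {x + y | x y. x \<in> P \<and> y \<in> Q} \<longrightarrow>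
     (\<exists>x y. x \<in> P \<and> y \<in> Q \<and> lattice_pt x \<and> lattice_pt y \<and> z = x + y))"

end

theory Submission
  imports Defs
begin

text \<open>
  Let \<open>w\<close> be the primitive normal of the bottom of \<open>P\<close>. At a vertex of the bottom two edges lie in the
  bottom, so by smoothness the third one has lattice height 1; hence every slice of \<open>P\<close> at an integral
  height is a lattice polygon. All of this is visible in the normal fan and therefore holds for \<open>P'\<close>
  with the same \<open>w\<close>. For every \<open>c\<close> some \<open>c + k w\<close> attains its maximum over \<open>P\<close>, and then also over \<open>P'\<close>,
  on a face joining bottom and top; by separation, a point of \<open>P + P'\<close> at height \<open>s + t\<close> is a sum of
  points at heights \<open>s\<close> and \<open>t\<close>. Taking \<open>s\<close> and \<open>t\<close> integral reduces the claim to lattice polygons \<open>A\<close>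
  and \<open>B\<close> in the plane such that every edge of \<open>B\<close> has a parallel edge of \<open>A\<close> with the same outer normal.

  For these, suppose \<open>K = z - A\<close> meets \<open>B\<close> without common lattice point. Then \<open>K\<close> crosses every
  unimodular triangle in \<open>B\<close> that it meets through exactly two of its edges, so it traverses a strip of
  triangles from one boundary edge of \<open>B\<close> to another one, and is narrower there than the two
  parallel edges of \<open>K\<close>, each of which lies beyond the opposite end. So the two sides of \<open>K\<close> would have
  to converge in both directions.
\<close>

section \<open>Pairs of lattice polygons\<close>

text \<open>Equal normal fans provide no map between \<open>P\<close> and \<open>P'\<close>; they
  only tell which functionals share maximizers. Hence faces appear as maximizer sets
  \<open>maxface\<close>, and the prism structure is reduced to \<open>prismlike\<close>. On a slice
  of constant height multiples of \<open>w\<close> are invisible, which is what leaves the summand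
  along \<open>w\<close> free to be chosen. In the plane no triangulation of \<open>B\<close> is
  fixed: the strip grows by one unimodular triangle at a time, the next vertex being a lattice point
  of \<open>B\<close> nearest to the line of the current edge. The absence of a common lattice point
  confines \<open>K\<close>, on the line of each such edge, to the open segment. Integrality makes
  positive barycentric coordinates at least 1, and this excludes a branching of the strip. The
  lengths that collide at the end are 1 for a primitive edge of the strip and at least 1 for an edge
  of \<open>K\<close> with two lattice points.\<close>

definition cr :: "real \<times> real \<Rightarrow> real \<times> real \<Rightarrow> real" where
  "cr u v = fst u * snd v - snd u * fst v"

definition side :: "real \<times> real \<Rightarrow> real \<times> real \<Rightarrow> real \<times> real \<Rightarrow> real" where
  "side p q x = cr (q - p) (x - p)"

definition integral2 :: "real \<times> real \<Rightarrow> bool" where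
  "integral2 x \<longleftrightarrow> fst x \<in> \<int> \<and> snd x \<in> \<int>"

text \<open>Primitivity is encoded by a completion to a lattice basis rather than by a gcd, because
  the complementary vector \<open>g\<close> supplies coordinates: \<open>cr x g\<close> and
  \<open>cr d x\<close> are those of \<open>x\<close> in the basis \<open>d\<close>,
  \<open>g\<close>.\<close>

definition primitive2 :: "real \<times> real \<Rightarrow> bool" where
  "primitive2 d \<longleftrightarrow> integral2 d \<and> (\<exists>g. integral2 g \<and> cr d g = 1)"

lemma integral2_add: "integral2 x \<Longrightarrow> integral2 y \<Longrightarrow> integral2 (x + y)"
  and integral2_diff: "integral2 x \<Longrightarrow> integral2 y \<Longrightarrow> integral2 (x - y)"
  and integral2_minus: "integral2 x \<Longrightarrow> integral2 (- x)"
  and integral2_scale: "c \<in> \<int> \<Longrightarrow> integral2 x \<Longrightarrow> integral2 (c *\<^sub>R x)"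
  by (auto simp: integral2_def)

lemma cr_Ints: "integral2 x \<Longrightarrow> integral2 y \<Longrightarrow> cr x y \<in> \<int>"
  by (auto simp: integral2_def cr_def)

lemma side_Ints: "integral2 p \<Longrightarrow> integral2 q \<Longrightarrow> integral2 x \<Longrightarrow> side p q x \<in> \<int>"
  by (simp add: side_def cr_Ints integral2_diff)

lemma side_swap: "side q p x = - side p q x"
  by (simp add: side_def cr_def algebra_simps)

lemma side_flip: "side p r q = - side p q r"
  by (simp add: side_def cr_def algebra_simps)

lemma side_self [simp]: "side p q p = 0" "side p q q = 0"
  by (simp_all add: side_def cr_def algebra_simps)

lemma side_comb: "side p q ((1 - t) *\<^sub>R x + t *\<^sub>R y) = (1 - t) * side p q x + t * side p q y"
  by (simp add: side_def cr_def algebra_simps)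

lemma side_bary: "side r q x = side p q x - side p r x - side p q r"
  by (simp add: side_def cr_def algebra_simps)

lemma cr_expand: "cr d g *\<^sub>R x = cr x g *\<^sub>R d + cr d x *\<^sub>R g"
  by (rule prod_eqI; simp add: cr_def algebra_simps)

lemma primitive2_collinear:
  assumes "cr d g = 1" "cr d x = 0"
  shows "x = cr x g *\<^sub>R d"
  using cr_expand[of d g x] assms by simp

lemma primitive2_minus:
  assumes "primitive2 d" shows "primitive2 (- d)"
proof -
  obtain g where "integral2 d" "integral2 g" "cr d g = 1" using assms unfolding primitive2_def by blast
  then show ?thesis unfolding primitive2_def
    by (intro conjI exI[of _ "- g"] integral2_minus) (auto simp: cr_def)
qed

lemma primitive2I_side:
  assumes "integral2 p" "integral2 q" "integral2 r" "side p q r = 1 \<or> side p q r = -1"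
  shows "primitive2 (q - p)"
  using assms(4)
proof
  assume "side p q r = 1"
  then show ?thesis using assms unfolding primitive2_def side_def by (blast intro: integral2_diff)
next
  assume "side p q r = -1"
  then have "cr (q - p) (p - r) = 1" by (simp add: side_def cr_def algebra_simps)
  then show ?thesis using assms unfolding primitive2_def by (blast intro: integral2_diff)
qed

lemma halfspace_side_convex: "convex {x. side p q x > 0}"
  unfolding convex_alt
proof (intro ballI allI impI, unfold mem_Collect_eq side_comb)
  fix x y u
  assume "0 < side p q x" "0 < side p q y" "0 \<le> u \<and> u \<le> (1::real)"
  then show "0 < (1 - u) * side p q x + u * side p q y"
    by (cases "u = 0") (simp_all add: add_nonneg_pos)
qed

text \<open>The minimizers of a functional on a convex hull form a face, and a face of a hull is the
  hull of the generators it contains.\<close>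

lemma exposed_hull:
  fixes y :: "'a::euclidean_space"
  assumes "finite S" "y \<in> convex hull S" and le: "\<And>x. x \<in> S \<Longrightarrow> a \<bullet> y \<le> a \<bullet> x"
  shows "y \<in> convex hull {x \<in> S. a \<bullet> x = a \<bullet> y}"
proof -
  define F where "F = convex hull S \<inter> {x. a \<bullet> x = a \<bullet> y}"
  have "convex hull S \<subseteq> {x. a \<bullet> x \<ge> a \<bullet> y}"
    using le by (intro hull_minimal) (auto simp: convex_halfspace_ge)
  then have "F face_of (convex hull S)" unfolding F_def
    by (intro face_of_Int_supporting_hyperplane_ge) auto
  then obtain S' where S': "S' \<subseteq> S" "F = convex hull S'"
    using face_of_convex_hull_subset finite_imp_compact[OF assms(1)] by metis
  then have "S' \<subseteq> {x \<in> S. a \<bullet> x = a \<bullet> y}" using hull_subset[of S' convex] by (auto simp: F_def)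
  moreover have "y \<in> F" using assms(2) by (simp add: F_def)
  ultimately show ?thesis using S'(2) hull_mono by blast
qed

section \<open>Crossing a lattice polygon through primitive segments\<close>

locale lattice_crossing =
  fixes K Q :: "(real \<times> real) set"
  assumes convK: "convex K" and convQ: "convex Q"
    and hullK: "K \<subseteq> convex hull {x \<in> K. integral2 x}"
    and finQ: "finite {x \<in> Q. integral2 x}"
    and disj: "\<And>x. x \<in> K \<Longrightarrow> x \<in> Q \<Longrightarrow> \<not> integral2 x"
begin

lemma combK: "x \<in> K \<Longrightarrow> y \<in> K \<Longrightarrow> 0 \<le> t \<Longrightarrow> t \<le> 1 \<Longrightarrow> (1 - t) *\<^sub>R x + t *\<^sub>R y \<in> K"
  using convK by (simp add: convex_alt)

text \<open>A door of \<open>Q\<close> through which \<open>K\<close> passes. The pair is ordered: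
  the crossing proceeds towards the side where \<open>side p q\<close> is negative, and swapping the
  end points reverses it.\<close>

definition gate :: "real \<times> real \<Rightarrow> real \<times> real \<Rightarrow> bool" where
  "gate p q \<longleftrightarrow> integral2 p \<and> integral2 q \<and> p \<in> Q \<and> q \<in> Q \<and> primitive2 (q - p) \<and>
     (\<exists>t. 0 \<le> t \<and> t \<le> 1 \<and> (1 - t) *\<^sub>R p + t *\<^sub>R q \<in> K)"

lemma gate_swap: "gate p q \<Longrightarrow> gate q p"
  unfolding gate_def
proof (elim conjE exE, intro conjI)
  fix t assume "primitive2 (q - p)" "0 \<le> t" "t \<le> 1" "(1 - t) *\<^sub>R p + t *\<^sub>R q \<in> K"
  then show "\<exists>t\<ge>0. t \<le> 1 \<and> (1 - t) *\<^sub>R q + t *\<^sub>R p \<in> K"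
    by (intro exI[of _ "1 - t"]) (simp add: add.commute)
  show "primitive2 (p - q)" using primitive2_minus[OF \<open>primitive2 (q - p)\<close>] by simp
qed

text \<open>Both end points are lattice points of \<open>Q\<close>, hence not in \<open>K\<close>. A
  point of \<open>K\<close> on the line at or beyond an end point would, together with the point of
  \<open>K\<close> on the segment, force that end point into \<open>K\<close> by convexity.\<close>

lemma gate_line:
  assumes g: "gate p q" and x: "x \<in> K" "side p q x = 0"
  obtains t where "0 < t" "t < 1" "x = (1 - t) *\<^sub>R p + t *\<^sub>R q"
proof -
  obtain h where h: "cr (q - p) h = 1" using g unfolding gate_def primitive2_def by blast
  define s where "s = cr (x - p) h"
  have xs: "x - p = s *\<^sub>R (q - p)"
    unfolding s_def by (rule primitive2_collinear[OF h]) (use x(2) in \<open>simp add: side_def\<close>)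
  have "x = p + (x - p)" by simp
  also have "\<dots> = (1 - s) *\<^sub>R p + s *\<^sub>R q" unfolding xs by (simp add: algebra_simps)
  finally have xs': "x = (1 - s) *\<^sub>R p + s *\<^sub>R q" .
  obtain t where t: "0 \<le> t" "t \<le> 1" "(1 - t) *\<^sub>R p + t *\<^sub>R q \<in> K"
    using g unfolding gate_def by blast
  have comb: "(1 - r) *\<^sub>R x + r *\<^sub>R ((1 - t) *\<^sub>R p + t *\<^sub>R q)
      = (1 - ((1 - r) * s + r * t)) *\<^sub>R p + ((1 - r) * s + r * t) *\<^sub>R q" for r
    unfolding xs' by (rule prod_eqI; simp add: algebra_simps)
  have pq: "p \<notin> K" "q \<notin> K" using g disj unfolding gate_def by blast+
  have "0 < s"
  proof (rule ccontr)
    assume "\<not> 0 < s"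
    then have s: "s \<le> 0" by simp
    have "t > 0" using t pq by (cases "t = 0") auto
    define r where "r = - s / (t - s)"
    have r: "0 \<le> r" "r \<le> 1" using s \<open>t > 0\<close> by (auto simp: r_def field_simps)
    have "r * (t - s) = - s" using s \<open>t > 0\<close> by (simp add: r_def)
    then have "(1 - r) * s + r * t = 0" by algebra
    then have "p \<in> K" using combK[OF x(1) t(3) r] comb[of r] by simp
    then show False using pq by simp
  qed
  moreover have "s < 1"
  proof (rule ccontr)
    assume "\<not> s < 1"
    then have s: "s \<ge> 1" by simp
    have "t < 1" using t pq by (cases "t = 1") auto
    define r where "r = (s - 1) / (s - t)"
    have r: "0 \<le> r" "r \<le> 1" using s \<open>t < 1\<close> by (auto simp: r_def field_simps)
    have "r * (s - t) = s - 1" using s \<open>t < 1\<close> by (simp add: r_def)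
    then have "(1 - r) * s + r * t = 1" by algebra
    then have "q \<in> K" using combK[OF x(1) t(3) r] comb[of r] by simp
    then show False using pq by simp
  qed
  ultimately show thesis using that xs' by blast
qed

lemma gate_point:
  assumes "gate p q"
  obtains x t where "x \<in> K" "0 < t" "t < 1" "x = (1 - t) *\<^sub>R p + t *\<^sub>R q"
proof -
  obtain t where t: "0 \<le> t" "t \<le> 1" "(1 - t) *\<^sub>R p + t *\<^sub>R q \<in> K"
    using assms unfolding gate_def by blast
  have "side p q ((1 - t) *\<^sub>R p + t *\<^sub>R q) = 0" by (simp add: side_comb)
  from gate_line[OF assms t(3) this] obtain u where "0 < u" "u < 1"
    "(1 - t) *\<^sub>R p + t *\<^sub>R q = (1 - u) *\<^sub>R p + u *\<^sub>R q" .
  with that[OF t(3)] show thesis by blast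
qed

text \<open>Otherwise all lattice points of \<open>K\<close> have nonnegative
  \<open>side p q\<close>. None is on the line, since by \<open>gate_line\<close> it would be
  interior to a primitive segment. So they, and with them \<open>K\<close>, lie strictly on one
  side, against the point of \<open>K\<close> on the gate.\<close>

lemma gate_above:
  assumes g: "gate p q"
  obtains k where "k \<in> K" "integral2 k" "side p q k < 0"
proof (rule ccontr)
  assume "\<not> thesis"
  then have neg: "\<And>k. k \<in> K \<Longrightarrow> integral2 k \<Longrightarrow> side p q k \<ge> 0"
    using that by force
  have pos: "side p q k > 0" if k: "k \<in> K" "integral2 k" for k
  proof (rule ccontr)
    assume "\<not> side p q k > 0"
    then have k0: "side p q k = 0" using neg[OF k] by simp
    obtain t where t: "0 < t" "t < 1" "k = (1 - t) *\<^sub>R p + t *\<^sub>R q"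
      using gate_line[OF g k(1) k0] by blast
    obtain h where h: "cr (q - p) h = 1" "integral2 h"
      using g unfolding gate_def primitive2_def by blast
    have "k - p = t *\<^sub>R (q - p)" using t by (simp add: algebra_simps)
    then have "cr (k - p) h = t * cr (q - p) h" by (simp only: cr_def fst_scaleR snd_scaleR) (simp add: algebra_simps)
    then have "t \<in> \<int>" using h k cr_Ints[of "k - p" h] integral2_diff[of k p] g
      unfolding gate_def by simp
    then obtain i where "t = real_of_int i" by (rule Ints_cases)
    then show False using t by simp
  qed
  then have "{x \<in> K. integral2 x} \<subseteq> {x. side p q x > 0}" using pos by auto
  then have "K \<subseteq> {x. side p q x > 0}"
    using hullK hull_minimal[of _ "{x. side p q x > 0}" convex] halfspace_side_convex by blast
  moreover obtain x t where "x \<in> K" "x = (1 - t) *\<^sub>R p + t *\<^sub>R q" by (rule gate_point[OF g])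
  ultimately show False by (auto simp: side_comb)
qed

text \<open>Where a segment of \<open>K\<close> from the far side of a gate to its near side meets the line of the gate,
  it lies between the end points of the gate, which controls the sign of the other two
  barycentric coordinates.\<close>

lemma gate_comb:
  assumes g: "gate p q" and xy: "x \<in> K" "y \<in> K" "side p q x < 0" "side p q y \<ge> 0"
    and f: "f p \<ge> 0" "f q \<ge> 0" "f p > 0 \<or> f q > 0"
      and aff: "\<And>t u v. f ((1 - t) *\<^sub>R u + t *\<^sub>R v) = (1 - t) * f u + t * f v"
  shows "side p q y * f x - side p q x * f y > (0::real)"
proof -
  \<comment> \<open>\<open>m\<close> is the point where the segment meets the line of the gate; the
    claimed expression is \<open>f m\<close> times the positive number
    \<open>side p q y - side p q x\<close>.\<close>
  define t where "t = - side p q x / (side p q y - side p q x)"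
  define m where "m = (1 - t) *\<^sub>R x + t *\<^sub>R y"
  have t: "0 \<le> t" "t \<le> 1" using xy by (auto simp: t_def field_simps)
  have "m \<in> K" using combK xy t by (simp add: m_def)
  moreover have "side p q m = 0" using xy unfolding m_def side_comb by (simp add: t_def field_simps)
  ultimately obtain s where s: "0 < s" "s < 1" "m = (1 - s) *\<^sub>R p + s *\<^sub>R q"
    by (rule gate_line[OF g])
  have "0 < (1 - s) * f p + s * f q"
    using f s by (auto intro: add_pos_nonneg add_nonneg_pos)
  then have "0 < f m" using s aff by simp
  then have "0 < (1 - t) * f x + t * f y" using aff by (simp add: m_def)
  moreover have d: "side p q y - side p q x > 0" using xy by simp
  moreover have "(side p q y - side p q x) * t = - side p q x" using d by (simp add: t_def)
  then have "(side p q y - side p q x) * ((1 - t) * f x + t * f y) = side p q y * f x - side p q x * f y"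
    by algebra
  ultimately show ?thesis by (metis zero_less_mult_iff)
qed

text \<open>The segment from \<open>x\<close> to \<open>y\<close> meets the line through
  \<open>p\<close> and \<open>r\<close> where the coordinate at \<open>q\<close> vanishes. Up to a
  positive factor the coordinate at \<open>p\<close> is there \<open>b' * a - b * a'\<close>, so the
  sign conditions put this point between \<open>p\<close> and \<open>r\<close>.\<close>

lemma edge_hit:
  assumes pr: "integral2 p" "integral2 r" "p \<in> Q" "r \<in> Q" "primitive2 (r - p)"
    and K: "x \<in> K" "y \<in> K"
    and x: "x = a *\<^sub>R p + b *\<^sub>R q + c *\<^sub>R r" "a + b + c = 1"
    and y: "y = a' *\<^sub>R p + b' *\<^sub>R q + c' *\<^sub>R r" "a' + b' + c' = 1"
    and sgn: "b < 0" "0 \<le> b'" "0 \<le> c" "0 \<le> c'" "0 \<le> b' * a - b * a'"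
  shows "gate p r"
proof -
  define t where "t = - b / (b' - b)"
  have t: "0 \<le> t" "t \<le> 1" using sgn by (auto simp: t_def field_simps)
  define m where "m = (1 - t) *\<^sub>R x + t *\<^sub>R y"
  have mK: "m \<in> K" using combK K t by (simp add: m_def)
  have tb: "(b' - b) * t = - b" using sgn by (simp add: t_def)
  have b0: "(1 - t) * b + t * b' = 0" using tb by algebra
  define A where "A = (1 - t) * a + t * a'"
  define C where "C = (1 - t) * c + t * c'"
  have "m = A *\<^sub>R p + ((1 - t) * b + t * b') *\<^sub>R q + C *\<^sub>R r"
    unfolding m_def x(1) y(1) A_def C_def by (rule prod_eqI; simp add: algebra_simps)
  then have m: "m = A *\<^sub>R p + C *\<^sub>R r" using b0 by simp
  have "(b' - b) * A = b' * a - b * a'" unfolding A_def using tb by algebra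
  moreover have "b' - b > 0" using sgn by simp
  ultimately have "A \<ge> 0" using sgn by (metis not_le mult_pos_neg)
  moreover have "C \<ge> 0" using sgn t by (simp add: C_def)
  moreover have "A + C = 1" unfolding A_def C_def using b0 x(2) y(2) by algebra
  moreover from this have "A = 1 - C" by simp
  ultimately show ?thesis using pr mK m unfolding gate_def
    by (intro conjI exI[of _ C]) auto
qed

text \<open>For a unimodular triangle the barycentric coordinates are \<open>side\<close> values
  without a denominator, hence integral at lattice points.\<close>

lemma barycentric:
  assumes "side p q r = -1"
  shows "x = side r q x *\<^sub>R p + side p r x *\<^sub>R q + side q p x *\<^sub>R r"
    and "side r q x + side p r x + side q p x = 1"
proof -
  have "(- side p q r) *\<^sub>R x = side r q x *\<^sub>R p + side p r x *\<^sub>R q + side q p x *\<^sub>R r"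
    by (rule prod_eqI; simp add: side_def cr_def algebra_simps)
  then show "x = side r q x *\<^sub>R p + side p r x *\<^sub>R q + side q p x *\<^sub>R r"
    using assms by simp
  show "side r q x + side p r x + side q p x = 1"
    using assms by (simp add: side_bary[of r q x p] side_swap[of q p])
qed

lemma Ints_pos_ge_1: "x \<in> \<int> \<Longrightarrow> 0 < x \<Longrightarrow> 1 \<le> (x::real)"
  by (elim Ints_cases) simp

text \<open>Take lattice points of \<open>K\<close>: \<open>k1\<close> beyond the edge
  \<open>p q\<close> and \<open>k2\<close> beyond \<open>p r\<close>. Their coordinates at
  \<open>p\<close> are positive, hence at least 1. As the coordinates add up to 1, the coordinate of
  \<open>k1\<close> at \<open>q\<close> and that of \<open>k2\<close> at \<open>r\<close> are at
  most the absolute value of the negative one. So the segment from \<open>k1\<close> to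
  \<open>k2\<close> meets the line of the gate \<open>p r\<close> at \<open>p\<close> or beyond it,
  where \<open>K\<close> has no points.\<close>

lemma not_three_gates:
  assumes g: "gate p q" "gate p r" "gate r q" and tri: "side p q r = -1"
  shows False
proof -
  have rq: "side r q p = 1" "side p r q = 1" "side q p r = 1" using tri
    by (simp_all add: side_def cr_def algebra_simps)
  have int: "integral2 p" "integral2 q" "integral2 r" using g unfolding gate_def by auto
  obtain k1 where k1: "k1 \<in> K" "integral2 k1" "side q p k1 < 0"
    by (rule gate_above[OF gate_swap[OF g(1)]])
  obtain k2 where k2: "k2 \<in> K" "integral2 k2" "side p r k2 < 0"
    by (rule gate_above[OF g(2)])
  \<comment> \<open>The points \<open>k0\<close>, \<open>k3\<close>, \<open>k4\<close> on the gates
    only fix signs: each has one vanishing coordinate, so \<open>gate_comb\<close> isolates the sign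
    of that coordinate of \<open>k1\<close> or \<open>k2\<close>.\<close>
  obtain k0 t0 where k0: "k0 \<in> K" "0 < t0" "t0 < 1" "k0 = (1 - t0) *\<^sub>R r + t0 *\<^sub>R q"
    by (rule gate_point[OF g(3)])
  have v0: "side p r k0 = t0" "side q p k0 = 1 - t0" "side r q k0 = 0"
    unfolding k0(4) side_comb using rq by simp_all
  obtain k3 t3 where k3: "k3 \<in> K" "0 < t3" "t3 < 1" "k3 = (1 - t3) *\<^sub>R p + t3 *\<^sub>R r"
    by (rule gate_point[OF g(2)])
  have v3: "side p r k3 = 0" "side q p k3 = t3" unfolding k3(4) side_comb using rq by simp_all
  obtain k4 t4 where k4: "k4 \<in> K" "0 < t4" "t4 < 1" "k4 = (1 - t4) *\<^sub>R p + t4 *\<^sub>R q"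
    by (rule gate_point[OF g(1)])
  have v4: "side p r k4 = t4" "side q p k4 = 0" unfolding k4(4) side_comb using rq by simp_all
  have a1: "side r q k1 > 0"
    using gate_comb[OF gate_swap[OF g(1)] k1(1) k0(1) k1(3), of "side r q"] rq v0 k0 side_comb
    by (simp add: zero_less_mult_iff)
  have a2: "side r q k2 > 0"
    using gate_comb[OF g(2) k2(1) k0(1) k2(3), of "side r q"] rq v0 k0 side_comb
    by (simp add: zero_less_mult_iff)
  have b1: "side p r k1 > 0"
    using gate_comb[OF gate_swap[OF g(1)] k1(1) k3(1) k1(3), of "side p r"] rq v3 k3 side_comb
    by (simp add: zero_less_mult_iff)
  have c2: "side q p k2 > 0"
    using gate_comb[OF g(2) k2(1) k4(1) k2(3), of "side q p"] rq v4 k4 side_comb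
    by (simp add: zero_less_mult_iff)
  have "1 \<le> side r q k1" "1 \<le> side r q k2"
    using a1 a2 int k1 k2 by (auto intro!: Ints_pos_ge_1 side_Ints)
  then have "side p r k1 \<le> - side q p k1" "side q p k2 \<le> - side p r k2"
    using barycentric(2)[OF tri, of k1] barycentric(2)[OF tri, of k2] by simp_all
  then have "side p r k1 * side q p k2 \<le> (- side q p k1) * (- side p r k2)"
    using b1 c2 by (intro mult_mono) auto
  moreover have "side p r k1 * side q p k2 - side p r k2 * side q p k1 > 0"
    using gate_comb[OF g(2) k2(1) k1(1) k2(3), of "side q p"] rq b1 side_comb by simp
  ultimately show False by (simp add: algebra_simps)
qed

text \<open>\<open>K\<close> has a lattice point beyond the gate, which is not in \<open>Q\<close>;
  so \<open>K\<close> leaves the triangle again, by \<open>not_three_gates\<close> through exactly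
  one of the two other edges. The second conclusion says that no part of \<open>K\<close> beyond the
  gate is lost, the third makes the walk terminate.\<close>

lemma gate_step:
  assumes g: "gate p q" and r: "integral2 r" "r \<in> Q" and tri: "side p q r = -1"
  obtains p' q' where "gate p' q'"
    "\<forall>x\<in>K. side p q x < 0 \<longrightarrow> x \<in> Q \<or> side p' q' x < 0"
    "{x \<in> K. side p' q' x < 0} \<subset> {x \<in> K. side p q x < 0}"
proof -
  have pq: "integral2 p" "integral2 q" "p \<in> Q" "q \<in> Q" using g unfolding gate_def by auto
  have rq: "side r q p = 1" "side p r q = 1" "side q p r = 1" using tri
    by (simp_all add: side_def cr_def algebra_simps)
  have pri: "primitive2 (r - p)" "primitive2 (r - q)"
    using primitive2I_side[of p r q] primitive2I_side[of q r p] pq r rq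
      side_flip[of q r p] by auto
  obtain y t where y: "y \<in> K" "0 < t" "t < 1" "y = (1 - t) *\<^sub>R p + t *\<^sub>R q"
    by (rule gate_point[OF g])
  have vy: "side r q y = 1 - t" "side p r y = t" "side q p y = 0"
    unfolding y(4) side_comb using rq by simp_all
  note bary = barycentric(1)[OF tri] barycentric(2)[OF tri]
  have bary': "x = side p r x *\<^sub>R q + side r q x *\<^sub>R p + side q p x *\<^sub>R r"
    "side p r x + side r q x + side q p x = 1" for x
    using bary[of x] by (simp_all add: add.commute add.left_commute)
  \<comment> \<open>The point \<open>y\<close> has the coordinates \<open>1 - t\<close>,
    \<open>t\<close>, \<open>0\<close>. The last condition tells on which side of the vertex
    \<open>r\<close> the line from \<open>y\<close> to \<open>x\<close> passes.\<close>
  have hit1: "gate p r" if "x \<in> K" "side p q x < 0" "side p r x < 0" "0 \<le> t * side r q x - side p r x * (1 - t)" for x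
    by (rule edge_hit[OF pq(1) r(1) pq(3) r(2) pri(1) that(1) y(1) bary bary])
      (use that vy y side_swap[of q p x] in \<open>auto simp: mult.commute\<close>)
  have hit2: "gate r q" if "x \<in> K" "side p q x < 0" "side r q x < 0" "0 \<le> (1 - t) * side p r x - side r q x * t" for x
    by (rule gate_swap, rule edge_hit[OF pq(2) r(1) pq(4) r(2) pri(2) that(1) y(1) bary' bary'])
      (use that vy y side_swap[of q p x] in \<open>auto simp: mult.commute\<close>)
  have inQ: "x \<in> Q" if "side p q x < 0" "side p r x \<ge> 0" "side r q x \<ge> 0" for x
  proof -
    have "side r q x *\<^sub>R p + side p r x *\<^sub>R q + side q p x *\<^sub>R r \<in> convex hull {p, q, r}"
      unfolding convex_hull_3 using that bary(2)[of x] side_swap[of q p x]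
      by (intro CollectI exI[of _ "side r q x"] exI[of _ "side p r x"] exI[of _ "side q p x"] conjI) auto
    then have "x \<in> convex hull {p, q, r}" using bary(1)[of x] by simp
    then show ?thesis using convQ pq r hull_minimal[of "{p,q,r}" Q convex] by blast
  qed
  obtain k where k: "k \<in> K" "integral2 k" "side p q k < 0" by (rule gate_above[OF g])
  have kQ: "k \<notin> Q" using disj k by blast
  consider "gate p r" "\<not> gate r q" | "gate r q" "\<not> gate p r" | "\<not> gate p r" "\<not> gate r q"
    using not_three_gates[OF g _ _ tri] by blast
  then show thesis
  proof cases
    case 1
    have a: "x \<in> Q \<or> side p r x < 0" if x: "x \<in> K" "side p q x < 0" for x
    proof (rule ccontr)
      assume n: "\<not> (x \<in> Q \<or> side p r x < 0)"
      then have "side r q x < 0" using inQ[of x] x by force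
      moreover have "0 \<le> (1 - t) * side p r x" using n y by simp
      moreover have "side r q x * t \<le> 0" using calculation y by (simp add: mult_nonpos_nonneg)
      ultimately have "gate r q" using hit2[OF x] by simp
      then show False using 1 by simp
    qed
    \<comment> \<open>A point of \<open>K\<close> on the new gate is beyond the old one but not
      beyond the new one. It makes the inclusion strict, and through \<open>gate_comb\<close> it
      shows that points beyond the new gate are beyond the old one.\<close>
    obtain z s where z: "z \<in> K" "0 < s" "s < 1" "z = (1 - s) *\<^sub>R p + s *\<^sub>R r"
      by (rule gate_point[OF 1(1)])
    have vz: "side p r z = 0" "side p q z < 0"
      unfolding z(4) side_comb using tri z by simp_all
    have b: "side p q x < 0" if x: "x \<in> K" "side p r x < 0" for x
    proof (rule ccontr)
      assume "\<not> side p q x < 0"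
      then have "side p q x * side p r z - side p q z * side p r x > 0"
        using gate_comb[OF g z(1) x(1) vz(2), of "side p r"] rq side_comb by simp
      then show False using vz x by (simp add: zero_less_mult_iff mult_less_0_iff)
    qed
    have "z \<in> {x \<in> K. side p q x < 0}" "z \<notin> {x \<in> K. side p r x < 0}" using z(1) vz by auto
    moreover have "{x \<in> K. side p r x < 0} \<subseteq> {x \<in> K. side p q x < 0}" using b by blast
    ultimately have "{x \<in> K. side p r x < 0} \<subset> {x \<in> K. side p q x < 0}" by blast
    then show thesis using that[OF 1(1)] a by blast
  next
    case 2
    have a: "x \<in> Q \<or> side r q x < 0" if x: "x \<in> K" "side p q x < 0" for x
    proof (rule ccontr)
      assume n: "\<not> (x \<in> Q \<or> side r q x < 0)"
      then have "side p r x < 0" using inQ[of x] x by force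
      moreover have "0 \<le> t * side r q x" using n y by simp
      moreover have "side p r x * (1 - t) \<le> 0" using calculation y by (simp add: mult_nonpos_nonneg)
      ultimately have "gate p r" using hit1[OF x] by simp
      then show False using 2 by simp
    qed
    obtain z s where z: "z \<in> K" "0 < s" "s < 1" "z = (1 - s) *\<^sub>R r + s *\<^sub>R q"
      by (rule gate_point[OF 2(1)])
    have vz: "side r q z = 0" "side p q z < 0"
      unfolding z(4) side_comb using tri z by simp_all
    have b: "side p q x < 0" if x: "x \<in> K" "side r q x < 0" for x
    proof (rule ccontr)
      assume "\<not> side p q x < 0"
      then have "side p q x * side r q z - side p q z * side r q x > 0"
        using gate_comb[OF g z(1) x(1) vz(2), of "side r q"] rq side_comb by simp
      then show False using vz x by (simp add: zero_less_mult_iff mult_less_0_iff)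
    qed
    have "z \<in> {x \<in> K. side p q x < 0}" "z \<notin> {x \<in> K. side r q x < 0}" using z(1) vz by auto
    moreover have "{x \<in> K. side r q x < 0} \<subseteq> {x \<in> K. side p q x < 0}" using b by blast
    ultimately have "{x \<in> K. side r q x < 0} \<subset> {x \<in> K. side p q x < 0}" by blast
    then show thesis using that[OF 2(1)] a by blast
  next
    case 3
    \<comment> \<open>\<open>u - v\<close> is the quantity tested in \<open>hit1\<close>, its
      negative the one in \<open>hit2\<close>. Without further gates a negative \<open>v\<close>
      forces \<open>u < v\<close> and a negative \<open>u\<close> forces \<open>v < u\<close>, yet
      one of them is negative.\<close>
    define u v where "u = t * side r q k" and "v = (1 - t) * side p r k"
    have "side p r k < 0 \<or> side r q k < 0" using inQ[of k] k kQ by force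
    then have "u < 0 \<or> v < 0" using y by (auto simp: u_def v_def mult_less_0_iff)
    moreover have "side p r k < 0 \<longleftrightarrow> v < 0" "side r q k < 0 \<longleftrightarrow> u < 0"
      using y by (auto simp: u_def v_def mult_less_0_iff)
    moreover have "v < 0 \<Longrightarrow> u - v < 0" "u < 0 \<Longrightarrow> v - u < 0"
      using hit1[OF k(1,3)] hit2[OF k(1,3)] 3 y calculation(2,3)
      by (auto simp: u_def v_def mult.commute not_le[symmetric])
    ultimately show thesis by linarith
  qed
qed

text \<open>Take a lattice point \<open>r\<close> of \<open>Q\<close> beyond the gate at the least
  lattice distance \<open>n\<close> from its line. If \<open>n\<close> were at least 2, the
  parallelogram spanned by \<open>q - p\<close> and \<open>r - p\<close> at \<open>p\<close> would
  contain a lattice point at distance 1; it or its reflection in the centre lies in the triangle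
  \<open>p q r\<close> and is closer than \<open>r\<close>.\<close>

lemma next_vertex:
  assumes g: "gate p q" and r0: "integral2 r0" "r0 \<in> Q" "side p q r0 < 0"
  obtains r where "integral2 r" "r \<in> Q" "side p q r = -1"
proof -
  have pq: "integral2 p" "integral2 q" "p \<in> Q" "q \<in> Q" using g unfolding gate_def by auto
  define R where "R = {x \<in> Q. integral2 x \<and> side p q x < 0}"
  have "finite R" using finQ by (rule finite_subset[rotated]) (auto simp: R_def)
  moreover have "r0 \<in> R" using r0 by (simp add: R_def)
  then have "R \<noteq> {}" by blast
  ultimately obtain r where r: "r \<in> R" and rmin: "\<And>x. x \<in> R \<Longrightarrow> - side p q r \<le> - side p q x"
    using arg_min_if_finite[of R "\<lambda>x. - side p q x"] by (metis not_less)
  define n where "n = - side p q r"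
  have rQ: "r \<in> Q" "integral2 r" "n > 0" using r by (auto simp: R_def n_def)
  obtain h where h: "cr (q - p) h = 1" "integral2 h" using g unfolding gate_def primitive2_def by blast
  define e where "e = cr (r - p) h"
  have re: "r - p = e *\<^sub>R (q - p) - n *\<^sub>R h"
    using cr_expand[of "q - p" h "r - p"] h unfolding e_def n_def side_def by simp
  have "n \<in> \<int>" "e \<in> \<int>" using pq rQ h by (auto simp: n_def e_def intro!: side_Ints cr_Ints integral2_diff)
  have "n = 1"
  proof (rule ccontr)
    assume "n \<noteq> 1"
    then have n2: "n \<ge> 2" using \<open>n \<in> \<int>\<close> \<open>n > 0\<close> by (auto elim!: Ints_cases)
    \<comment> \<open>The lattice points at distance 1 are spaced by \<open>q - p\<close>; rounding
      up selects the one with \<open>0 \<le> b\<close> and \<open>b < 1\<close>.\<close>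
    define j where "j = real_of_int \<lceil>e / n\<rceil>"
    define b where "b = j - e / n"
    have b: "0 \<le> b" "b < 1" unfolding b_def j_def by linarith+
    define x where "x = p + (j *\<^sub>R (q - p) - h)"
    have xint: "integral2 x" unfolding x_def j_def using pq h
      by (intro integral2_add integral2_diff integral2_scale) auto
    have sx: "side p q x = -1" using h(1) unfolding x_def by (simp add: side_def cr_def algebra_simps)
    have "(1 / n) *\<^sub>R (r - p) = (e / n) *\<^sub>R (q - p) - h"
      unfolding re using n2 by (simp add: scaleR_diff_right)
    then have "x = p + ((1 / n) *\<^sub>R (r - p) + b *\<^sub>R (q - p))"
      unfolding x_def b_def by (simp add: algebra_simps)
    then have xb: "x = (1 - b - 1 / n) *\<^sub>R p + b *\<^sub>R q + (1 / n) *\<^sub>R r"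
      by (simp add: algebra_simps)
    have inQ: "u *\<^sub>R p + v *\<^sub>R q + w *\<^sub>R r \<in> Q" if "0 \<le> u" "0 \<le> v" "0 \<le> w" "u + v + w = 1" for u v w
    proof -
      have "u *\<^sub>R p + v *\<^sub>R q + w *\<^sub>R r \<in> convex hull {p, q, r}"
        unfolding convex_hull_3 using that by blast
      then show ?thesis using convQ pq rQ hull_minimal[of "{p,q,r}" Q convex] by blast
    qed
    have n1: "0 < 1 / n" "1 / n \<le> 1" using n2 by (auto simp: field_simps)
    show False
    proof (cases "b \<le> 1 - 1 / n")
      case True
      then have "x \<in> Q" unfolding xb using b n1 by (intro inQ) auto
      then have "x \<in> R" using xint sx by (simp add: R_def)
      then show False using rmin[of x] sx n2 by (simp add: n_def)
    next
      case False
      \<comment> \<open>Reflection in the midpoint of \<open>q\<close> and \<open>r\<close> swaps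
        the two halves of the parallelogram and the distances 1 and \<open>n - 1\<close>.\<close>
      define x' where "x' = q + r - x"
      have "x' = (1 - (1 - b) - (1 - 1 / n)) *\<^sub>R p + (1 - b) *\<^sub>R q + (1 - 1 / n) *\<^sub>R r"
        unfolding x'_def xb by (simp add: algebra_simps)
      then have "x' \<in> Q" using False b n1 by (simp only:) (intro inQ; simp)
      moreover have "side p q x' = 1 - n"
        using sx unfolding x'_def n_def by (simp add: side_def cr_def algebra_simps)
      moreover have "integral2 x'" unfolding x'_def using xint pq rQ by (intro integral2_add integral2_diff)
      ultimately have "x' \<in> R" using n2 by (simp add: R_def)
      then show False using rmin[of x'] \<open>side p q x' = 1 - n\<close> by (simp add: n_def)
    qed
  qed
  then show thesis using that[of r] rQ by (simp add: n_def)
qed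

text \<open>An iteration of \<open>gate_step\<close>, phrased as a minimal choice: among the
  finitely many gates with the invariant, take one with the least part of \<open>K\<close> beyond
  it. If lattice points of \<open>Q\<close> remained beyond, \<open>next_vertex\<close> would supply
  another triangle.\<close>

lemma gate_walk:
  assumes g: "gate p q"
  obtains p' q' where "gate p' q'" "\<forall>x\<in>Q. integral2 x \<longrightarrow> side p' q' x \<ge> 0"
    "\<forall>x\<in>K. side p q x > 0 \<or> x \<in> Q \<or> side p' q' x < 0"
proof -
  define A where "A p q = {x \<in> K. side p q x < 0}" for p q
  define G where "G = {(p', q'). gate p' q' \<and> (\<forall>x\<in>K. side p q x > 0 \<or> x \<in> Q \<or> side p' q' x < 0)}"
  have line: "x \<in> Q" if "x \<in> K" "side p q x = 0" for x
    using gate_line[OF g that] g convQ unfolding gate_def convex_alt by (metis less_eq_real_def)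
  have "(p, q) \<in> G" unfolding G_def using g line by force
  moreover have "G \<subseteq> {x \<in> Q. integral2 x} \<times> {x \<in> Q. integral2 x}" unfolding G_def gate_def by auto
  then have "finite G" using finQ by (meson finite_SigmaI finite_subset)
  ultimately obtain B where B: "B \<in> case_prod A ` G" and Bmin: "\<forall>C\<in>case_prod A ` G. C \<subseteq> B \<longrightarrow> B = C"
    using finite_has_minimal[of "case_prod A ` G"] by (metis empty_iff finite_imageI image_is_empty)
  then obtain p' q' where pq': "(p', q') \<in> G" "B = A p' q'" by auto
  have g': "gate p' q'" and inv: "\<forall>x\<in>K. side p q x > 0 \<or> x \<in> Q \<or> side p' q' x < 0"
    using pq' by (auto simp: G_def)
  have "side p' q' x \<ge> 0" if x: "x \<in> Q" "integral2 x" for x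
  proof (rule ccontr)
    assume "\<not> side p' q' x \<ge> 0"
    then obtain r where r: "integral2 r" "r \<in> Q" "side p' q' r = -1"
      using next_vertex[OF g' x(2,1)] by force
    obtain p'' q'' where s: "gate p'' q''"
      "\<forall>x\<in>K. side p' q' x < 0 \<longrightarrow> x \<in> Q \<or> side p'' q'' x < 0"
      "{x \<in> K. side p'' q'' x < 0} \<subset> {x \<in> K. side p' q' x < 0}"
      by (rule gate_step[OF g' r])
    have "(p'', q'') \<in> G" using s(1,2) inv unfolding G_def by blast
    then have "A p'' q'' \<in> case_prod A ` G" by force
    then show False using Bmin s(3) unfolding A_def pq'(2) by blast
  qed
  then show thesis using that[OF g'] inv by blast
qed

text \<open>\<open>K\<close> has a lattice point outside \<open>Q\<close>, so it meets the frontier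
  of \<open>Q\<close> in a point \<open>y\<close>, which is not a lattice point. The lattice points
  of \<open>Q\<close> next to \<open>y\<close> on both sides along a supporting line form the gate.
  If \<open>Q\<close> is degenerate, a line containing it takes the role of the supporting
  line.\<close>

lemma boundary_gate:
  assumes hullQ: "Q = convex hull {x \<in> Q. integral2 x}" and x0: "x0 \<in> K" "x0 \<in> Q"
  obtains p q where "gate p q" "\<And>x. x \<in> Q \<Longrightarrow> side p q x \<le> 0"
proof -
  define S where "S = {x \<in> Q. integral2 x}"
  have "finite S" using finQ by (simp add: S_def)
  have QS: "Q = convex hull S" using hullQ by (simp add: S_def)
  have "closed Q" using QS \<open>finite S\<close> by (metis compact_imp_closed finite_imp_compact_convex_hull)
  have "{x \<in> K. integral2 x} \<noteq> {}"
  proof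
    assume "{x \<in> K. integral2 x} = {}"
    then show False using hullK x0 by (metis convex_hull_empty empty_iff subsetD)
  qed
  then obtain k where k: "k \<in> K" "k \<notin> Q" using disj by blast
  have "closed_segment x0 k \<inter> frontier Q \<noteq> {}"
    using x0 k by (intro connected_Int_frontier) auto
  then obtain y where y: "y \<in> closed_segment x0 k" "y \<in> frontier Q" by blast
  have yK: "y \<in> K" using y(1) x0 k convK convex_contains_segment by blast
  have yQ: "y \<in> Q" "y \<notin> interior Q" using y(2) \<open>closed Q\<close> by (auto simp: frontier_def)
  obtain a where a: "a \<noteq> 0" "\<And>x. x \<in> Q \<Longrightarrow> a \<bullet> y \<le> a \<bullet> x"
  proof (cases "interior Q = {}")
    case True
    then obtain a b where "a \<noteq> 0" "Q \<subseteq> {x. a \<bullet> x = b}"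
      using empty_interior_subset_hyperplane[OF convQ] by metis
    moreover from this have "a \<bullet> y = b" using yQ(1) by blast
    ultimately show ?thesis using that[of a] by force
  next
    case False
    then have "y \<notin> rel_interior Q" using yQ(2) rel_interior_nonempty_interior by blast
    then show ?thesis using supporting_hyperplane_rel_boundary[OF convQ yQ(1)] that by metis
  qed
  define T where "T = {x \<in> S. a \<bullet> x = a \<bullet> y}"
  have "finite T" using \<open>finite S\<close> by (simp add: T_def)
  have "y \<in> convex hull S" using yQ(1) QS by simp
  then have "y \<in> convex hull T" unfolding T_def
    by (rule exposed_hull[OF \<open>finite S\<close>]) (use a(2) in \<open>simp add: S_def\<close>)
  \<comment> \<open>\<open>e\<close> is \<open>a\<close> turned by a right angle and orders the
    points of the supporting line.\<close>
  define e where "e = (- snd a, fst a)"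
  have "y \<notin> S" using disj yK yQ by (auto simp: S_def)
  have uniq: "x = y" if "a \<bullet> x = a \<bullet> y" "e \<bullet> x = e \<bullet> y" for x
  proof -
    define u v where "u = fst x - fst y" and "v = snd x - snd y"
    have *: "fst a * u + snd a * v = 0" "fst a * v - snd a * u = 0"
      using that unfolding e_def u_def v_def by (simp_all add: inner_prod_def algebra_simps)
    have "((fst a)\<^sup>2 + (snd a)\<^sup>2) * u = fst a * (fst a * u + snd a * v) - snd a * (fst a * v - snd a * u)"
      "((fst a)\<^sup>2 + (snd a)\<^sup>2) * v = snd a * (fst a * u + snd a * v) + fst a * (fst a * v - snd a * u)"
      by (simp_all add: power2_eq_square algebra_simps)
    moreover have "(fst a)\<^sup>2 + (snd a)\<^sup>2 \<noteq> 0" using a(1) by (simp add: sum_power2_eq_zero_iff prod_eq_iff)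
    ultimately have "u = 0" "v = 0" using * by auto
    then show ?thesis by (simp add: u_def v_def prod_eq_iff)
  qed
  \<comment> \<open>\<open>y\<close> is in the hull of the lattice points of \<open>Q\<close> on the
    line; if they avoided one side of \<open>y\<close>, \<open>exposed_hull\<close> would make
    \<open>y\<close> one of them.\<close>
  have ex: "\<exists>x\<in>T. f \<bullet> x < f \<bullet> y" if f: "f = e \<or> f = - e" for f
  proof (rule ccontr)
    assume "\<not> ?thesis"
    then have "y \<in> convex hull {x \<in> T. f \<bullet> x = f \<bullet> y}"
      by (intro exposed_hull[OF \<open>finite T\<close> \<open>y \<in> convex hull T\<close>]) (simp add: not_less)
    moreover have "{x \<in> T. f \<bullet> x = f \<bullet> y} = {}"
    proof -
      have "x = y" if "x \<in> T" "f \<bullet> x = f \<bullet> y" for x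
        using uniq[of x] that f by (auto simp: T_def)
      then show ?thesis using \<open>y \<notin> S\<close> by (auto simp: T_def)
    qed
    ultimately show False by simp
  qed
  define L where "L = {x \<in> T. e \<bullet> x < e \<bullet> y}"
  define R where "R = {x \<in> T. e \<bullet> y < e \<bullet> x}"
  have LR: "finite L" "L \<noteq> {}" "finite R" "R \<noteq> {}"
    using ex[of e] ex[of "- e"] \<open>finite T\<close> by (auto simp: L_def R_def)
  obtain p where p: "p \<in> L" "\<And>x. x \<in> L \<Longrightarrow> e \<bullet> x \<le> e \<bullet> p"
    using arg_min_if_finite[of L "\<lambda>x. - (e \<bullet> x)"] LR by (metis neg_le_iff_le not_less)
  obtain q where q: "q \<in> R" "\<And>x. x \<in> R \<Longrightarrow> e \<bullet> q \<le> e \<bullet> x"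
    using arg_min_if_finite[of R "\<lambda>x. e \<bullet> x"] LR by (metis not_less)
  have pT: "integral2 p" "p \<in> Q" "a \<bullet> p = a \<bullet> y" "e \<bullet> p < e \<bullet> y"
    and qT: "integral2 q" "q \<in> Q" "a \<bullet> q = a \<bullet> y" "e \<bullet> y < e \<bullet> q"
    using p q by (auto simp: L_def R_def T_def S_def)
  define t where "t = (e \<bullet> y - e \<bullet> p) / (e \<bullet> q - e \<bullet> p)"
  have t: "0 \<le> t" "t \<le> 1" using pT qT by (auto simp: t_def field_simps)
  have tt: "t * (e \<bullet> q - e \<bullet> p) = e \<bullet> y - e \<bullet> p" using pT qT by (simp add: t_def)
  have "y = (1 - t) *\<^sub>R p + t *\<^sub>R q"
    by (rule uniq[symmetric]) (use pT qT tt in \<open>simp_all add: inner_add_right algebra_simps\<close>)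
  have pri: "primitive2 (q - p)"
  proof -
    obtain m n where mn: "fst (q - p) = of_int m" "snd (q - p) = of_int n"
      using integral2_diff[OF qT(1) pT(1)] unfolding integral2_def by (metis Ints_cases)
    define g where "g = gcd m n"
    have "q - p \<noteq> 0" using pT qT by auto
    then have "g \<noteq> 0" using mn by (auto simp: g_def prod_eq_iff)
    then have g0: "g > 0" by (simp add: g_def)
    have "g = 1"
    proof (rule ccontr)
      assume "g \<noteq> 1"
      then have g1: "g > 1" using g0 by simp
      \<comment> \<open>With a common factor \<open>g\<close> this would be a lattice point strictly
        between \<open>p\<close> and \<open>q\<close>: equal to \<open>y\<close>, or closer to
        \<open>y\<close> than the end point on its side.\<close>
      define x where "x = p + (1 / of_int g) *\<^sub>R (q - p)"
      obtain m' n' where mn': "m = g * m'" "n = g * n'" unfolding g_def by (meson dvdE gcd_dvd1 gcd_dvd2)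
      have "(1 / of_int g) *\<^sub>R (q - p) = (of_int m', of_int n')"
        using mn mn' g0 by (simp add: prod_eq_iff)
      then have "integral2 x" unfolding x_def using pT by (intro integral2_add) (auto simp: integral2_def)
      have ig: "0 < 1 / real_of_int g" "1 / real_of_int g < 1" using g1 by auto
      have xx: "x = (1 - 1 / of_int g) *\<^sub>R p + (1 / of_int g) *\<^sub>R q" unfolding x_def by (simp add: algebra_simps)
      have "x \<in> Q" using xx ig pT qT convQ unfolding convex_alt by simp
      have ax: "a \<bullet> x = a \<bullet> y" unfolding x_def using pT qT by (simp add: inner_add_right inner_diff_right)
      have xT: "x \<in> T" using \<open>integral2 x\<close> \<open>x \<in> Q\<close> ax by (simp add: T_def S_def)
      have exx: "e \<bullet> x = e \<bullet> p + (1 / of_int g) * (e \<bullet> q - e \<bullet> p)"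
        unfolding x_def by (simp add: inner_add_right inner_diff_right)
      have d: "e \<bullet> q - e \<bullet> p > 0" using pT qT by simp
      have lo: "e \<bullet> p < e \<bullet> x" using exx d ig by simp
      have "(1 / of_int g) * (e \<bullet> q - e \<bullet> p) < 1 * (e \<bullet> q - e \<bullet> p)"
        using d ig by (intro mult_strict_right_mono) auto
      then have hi: "e \<bullet> x < e \<bullet> q" using exx by simp
      consider "e \<bullet> x < e \<bullet> y" | "e \<bullet> x > e \<bullet> y" | "e \<bullet> x = e \<bullet> y" by linarith
      then show False
      proof cases
        case 1 then show False using p(2)[of x] xT lo by (simp add: L_def)
      next
        case 2 then show False using q(2)[of x] xT hi by (simp add: R_def)
      next
        case 3 then show False using uniq[OF ax] xT \<open>y \<notin> S\<close> by (auto simp: T_def)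
      qed
    qed
    then obtain u v where "u * m + v * n = 1" using bezout_int[of m n] by (auto simp: g_def)
    then have "real_of_int u * of_int m + of_int v * of_int n = 1"
      by (metis of_int_1 of_int_add of_int_mult)
    then have "cr (q - p) (- of_int v, of_int u) = 1" using mn by (simp add: cr_def algebra_simps)
    moreover have "integral2 (- of_int v, of_int u)" by (simp add: integral2_def)
    ultimately show ?thesis unfolding primitive2_def using integral2_diff[OF qT(1) pT(1)] by blast
  qed
  have g: "gate p q" unfolding gate_def using pT qT pri t yK \<open>y = _\<close> by blast
  \<comment> \<open>On all of the plane \<open>side p q\<close> is a multiple of the signed distance
    to the supporting line; the sign of \<open>s\<close> decides which order of the end points has
    \<open>Q\<close> on the nonpositive side.\<close>
  define s where "s = cr (q - p) a"
  have sd: "(a \<bullet> a) * side p q x = s * (a \<bullet> x - a \<bullet> y)" for x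
  proof -
    have "a \<bullet> q - a \<bullet> p = 0" using pT(3) qT(3) by simp
    moreover have "(a \<bullet> a) * side p q x - s * (a \<bullet> x - a \<bullet> p) = cr a (x - p) * (a \<bullet> q - a \<bullet> p)"
      unfolding s_def side_def cr_def by (simp add: inner_prod_def algebra_simps)
    ultimately show ?thesis using pT(3) by simp
  qed
  have aa: "a \<bullet> a > 0" using a(1) by simp
  show thesis
  proof (cases "s \<le> 0")
    case True
    have "side p q x \<le> 0" if "x \<in> Q" for x
      using sd[of x] a(2)[OF that] True aa by (metis diff_ge_0_iff_ge mult_nonpos_nonneg not_le mult_pos_pos)
    then show ?thesis using that[OF g] by blast
  next
    case False
    have "side q p x \<le> 0" if "x \<in> Q" for x
    proof -
      have "(a \<bullet> a) * side p q x \<ge> 0" using sd[of x] a(2)[OF that] False by simp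
      then show ?thesis using aa side_swap[of q p x] by (simp add: zero_le_mult_iff)
    qed
    then show ?thesis using that[OF gate_swap[OF g]] by blast
  qed
qed

text \<open>If \<open>K\<close> contains a segment parallel to a gate and at least as long, the two lines joining it
  to points beyond the gate converge, since both cross the gate.\<close>

lemma gate_narrows:
  assumes g: "gate p q" and K: "x \<in> K" "x' \<in> K" "y \<in> K" "y' \<in> K"
    and s: "side p q x < 0" "side p q x' < 0" "side p q y > 0" "side p q y' > 0"
    and j: "x' - x = j *\<^sub>R (q - p)" "\<bar>j\<bar> \<ge> 1"
  shows "j * cr (y' - x') (y - x) < 0"
proof -
  have pt: "\<exists>a t. 0 < a \<and> 0 < t \<and> t < 1 \<and> x + a *\<^sub>R (y - x) = (1 - t) *\<^sub>R p + t *\<^sub>R q"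
    if "x \<in> K" "y \<in> K" "side p q x < 0" "side p q y > 0" for x y
  proof -
    define a where "a = - side p q x / (side p q y - side p q x)"
    have a: "0 < a" "a \<le> 1" using that by (auto simp: a_def field_simps)
    define m where "m = (1 - a) *\<^sub>R x + a *\<^sub>R y"
    have "a * (side p q y - side p q x) = - side p q x" using that by (simp add: a_def)
    then have "side p q m = 0" unfolding m_def side_comb by algebra
    moreover have "m \<in> K" unfolding m_def using combK that a by simp
    ultimately obtain t where "0 < t" "t < 1" "m = (1 - t) *\<^sub>R p + t *\<^sub>R q"
      using gate_line[OF g] by blast
    moreover have "m = x + a *\<^sub>R (y - x)" by (simp add: m_def algebra_simps)
    ultimately show ?thesis using a by metis
  qed
  obtain a t where a: "0 < a" "0 < t" "t < 1" "x + a *\<^sub>R (y - x) = (1 - t) *\<^sub>R p + t *\<^sub>R q"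
    using pt K s by blast
  obtain b u where b: "0 < b" "0 < u" "u < 1" "x' + b *\<^sub>R (y' - x') = (1 - u) *\<^sub>R p + u *\<^sub>R q"
    using pt K s by blast
  define l where "l = y - x"
  define r where "r = y' - x'"
  define d where "d = q - p"
  \<comment> \<open>The two lines start \<open>j\<close> gate lengths apart and meet the gate less
    than one gate length apart. Pairing the resulting relation with \<open>l\<close> eliminates
    \<open>a\<close> and leaves the determinant of the directions.\<close>
  have "(x' - x) + b *\<^sub>R r - a *\<^sub>R l = (x' + b *\<^sub>R (y' - x')) - (x + a *\<^sub>R (y - x))"
    by (simp add: r_def l_def)
  also have "\<dots> = (u - t) *\<^sub>R d" unfolding a(4) b(4) by (simp add: d_def algebra_simps)
  finally have v: "j *\<^sub>R d + b *\<^sub>R r - a *\<^sub>R l = (u - t) *\<^sub>R d" by (simp only: j d_def)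
  have "cr (j *\<^sub>R d + b *\<^sub>R r - a *\<^sub>R l) l = (u - t) * cr d l"
    unfolding v by (simp add: cr_def algebra_simps)
  moreover have "cr (j *\<^sub>R d + b *\<^sub>R r - a *\<^sub>R l) l = j * cr d l + b * cr r l"
    by (simp add: cr_def algebra_simps)
  ultimately have "b * cr r l = (u - t - j) * cr d l" by algebra
  then have e: "b * (j * cr r l) = j * (u - t - j) * cr d l" by algebra
  have "cr d l = side p q y - side p q x" by (simp add: d_def l_def side_def cr_def algebra_simps)
  then have "cr d l > 0" using s by simp
  moreover have "j * (u - t - j) < 0" using j(2) a b
    by (cases "j > 0") (auto simp: mult_less_0_iff)
  ultimately have "b * (j * cr r l) < 0" unfolding e by (rule mult_neg_pos[rotated])
  then show ?thesis using b(1) by (simp add: r_def l_def mult_less_0_iff)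
qed

text \<open>In \<open>opp\<close> the edge of \<open>K\<close> appears through minima of
  \<open>side p q\<close>, because \<open>K\<close> is a reflected polygon: its outer normal there
  is opposite to that of the boundary edge of \<open>Q\<close>.\<close>

lemma no_crossing:
  assumes hullQ: "Q = convex hull {x \<in> Q. integral2 x}" and x0: "x0 \<in> K" "x0 \<in> Q"
    and opp: "\<And>p q. integral2 p \<Longrightarrow> integral2 q \<Longrightarrow> p \<in> Q \<Longrightarrow> q \<in> Q \<Longrightarrow> p \<noteq> q \<Longrightarrow>
      (\<And>x. x \<in> Q \<Longrightarrow> side p q x \<le> 0) \<Longrightarrow>
      \<exists>x x'. x \<in> K \<and> x' \<in> K \<and> integral2 x \<and> integral2 x' \<and> x \<noteq> x' \<and> 
        (\<forall>k\<in>K. side p q x \<le> side p q k) \<and> (\<forall>k\<in>K. side p q x' \<le> side p q k)"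
  shows False
proof -
  obtain p q where g: "gate p q" and pq: "\<And>x. x \<in> Q \<Longrightarrow> side p q x \<le> 0"
    using boundary_gate[OF hullQ x0] by blast
  obtain p' q' where g': "gate p' q'" and pq': "\<forall>x\<in>Q. integral2 x \<longrightarrow> side p' q' x \<ge> 0"
    and inv: "\<forall>x\<in>K. side p q x > 0 \<or> x \<in> Q \<or> side p' q' x < 0"
    by (rule gate_walk[OF g])
  \<comment> \<open>Used at both ends of the strip, at the last gate with reversed orientation. The
    two minimizers are lattice points, hence outside \<open>Q\<close>, and differ by a nonzero
    integral multiple of the primitive vector \<open>q - p\<close>.\<close>
  have bottom: "\<exists>x x' j. x \<in> K \<and> x' \<in> K \<and> x \<notin> Q \<and> x' \<notin> Q \<and> side p q x < 0 \<and> side p q x' < 0 \<and>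
      x' - x = j *\<^sub>R (q - p) \<and> \<bar>j\<bar> \<ge> 1"
    if g: "gate p q" and pq: "\<And>x. x \<in> Q \<Longrightarrow> side p q x \<le> 0" for p q
  proof -
    have int: "integral2 p" "integral2 q" "p \<in> Q" "q \<in> Q" using g unfolding gate_def by auto
    obtain h where h: "cr (q - p) h = 1" "integral2 h" using g unfolding gate_def primitive2_def by blast
    then have "p \<noteq> q" by (auto simp: cr_def)
    then obtain x x' where x: "x \<in> K" "x' \<in> K" "integral2 x" "integral2 x'" "x \<noteq> x'"
      "\<forall>k\<in>K. side p q x \<le> side p q k" "\<forall>k\<in>K. side p q x' \<le> side p q k"
      using opp int pq by metis
    obtain k where k: "k \<in> K" "side p q k < 0" using gate_above[OF g] by blast
    have eq: "side p q x = side p q x'" using x by (simp add: order_antisym)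
    have neg: "side p q x < 0" "side p q x' < 0" using x k by force+
    define j where "j = cr (x' - x) h"
    have j: "x' - x = j *\<^sub>R (q - p)" unfolding j_def
      by (rule primitive2_collinear[OF h(1)]) (use eq in \<open>simp add: side_def cr_def algebra_simps\<close>)
    have "j \<in> \<int>" unfolding j_def by (intro cr_Ints integral2_diff x h)
    moreover have "j \<noteq> 0" using j x by auto
    ultimately have "\<bar>j\<bar> \<ge> 1" by (auto elim!: Ints_cases)
    then show ?thesis using x neg j disj by blast
  qed
  have "Q \<subseteq> {x. side q' p' x \<le> 0}"
  proof -
    have "convex {x. side q' p' x \<le> 0}"
      unfolding convex_alt by (auto simp: side_comb intro!: add_nonpos_nonpos mult_nonneg_nonpos)
    then show ?thesis using pq' hullQ hull_minimal[of "{x \<in> Q. integral2 x}" "{x. side q' p' x \<le> 0}" convex]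
      by (auto simp: side_swap[of q' p'])
  qed
  then obtain y y' i where y: "y \<in> K" "y' \<in> K" "y \<notin> Q" "y' \<notin> Q" "side q' p' y < 0" "side q' p' y' < 0"
      "y' - y = i *\<^sub>R (p' - q')" "\<bar>i\<bar> \<ge> 1"
    using bottom[OF gate_swap[OF g']] by blast
  obtain x x' j where x: "x \<in> K" "x' \<in> K" "x \<notin> Q" "x' \<notin> Q" "side p q x < 0" "side p q x' < 0"
      "x' - x = j *\<^sub>R (q - p)" "\<bar>j\<bar> \<ge> 1"
    using bottom[OF g pq] by blast
  \<comment> \<open>Invariant of the walk: a point of \<open>K\<close> outside \<open>Q\<close> that
    is beyond the first gate is also beyond the last one, and one not beyond the last lies before
    the first.\<close>
  have xs: "side q' p' x > 0" "side q' p' x' > 0"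
    using bspec[OF inv x(1)] bspec[OF inv x(2)] x side_swap[of q' p'] by auto
  have ys: "side p q y > 0" "side p q y' > 0"
    using bspec[OF inv y(1)] bspec[OF inv y(2)] y side_swap[of q' p'] by auto
  have "y - y' = - (y' - y)" by simp
  then have y2: "y - y' = (- i) *\<^sub>R (p' - q')" "\<bar>- i\<bar> \<ge> 1" using y(8) unfolding y(7) by simp_all
  have cr_flip: "cr (b - a) (d - c) = cr (a - b) (c - d)" for a b c d by (simp add: cr_def algebra_simps)
  \<comment> \<open>The end points of the two edges of \<open>K\<close> are joined in both possible
    ways, so no labelling as left and right is needed: the first pairing gives \<open>i\<close> and
    \<open>j\<close> equal signs, the crossed one opposite signs.\<close>
  have "j * cr (y' - x') (y - x) < 0" "i * cr (y' - x') (y - x) < 0"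
    using gate_narrows[OF g x(1,2) y(1,2) x(5,6) ys x(7,8)]
      gate_narrows[OF gate_swap[OF g'] y(1,2) x(1,2) y(5,6) xs y(7,8)] cr_flip[of y' x' y x] by simp_all
  moreover have "j * cr (y - x') (y' - x) < 0" 
    using gate_narrows[OF g x(1,2) y(2,1) x(5,6) ys(2,1) x(7,8)] .
  moreover have "- i * cr (y - x') (y' - x) < 0" 
    using gate_narrows[OF gate_swap[OF g'] y(2,1) x(1,2) y(6,5) xs y2] cr_flip[of y x' y' x] by simp
  ultimately show False by (auto simp: mult_less_0_iff zero_less_mult_iff)
qed

end

text \<open>With \<open>z = a0 + b0\<close>, a lattice point \<open>x\<close> common to the
  reflected polygon and \<open>B\<close> is the same as a decomposition of \<open>z\<close> into
  \<open>z - x\<close> and \<open>x\<close>. The edge condition is directed, from \<open>B\<close>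
  to \<open>A\<close>; segments and points are covered as well.\<close>

lemma polygon_pair_integral:
  fixes A B :: "(real \<times> real) set"
  assumes A: "A = convex hull {x \<in> A. integral2 x}"
    and B: "B = convex hull {x \<in> B. integral2 x}" "finite {x \<in> B. integral2 x}"
    and edges: "\<And>c p q. c \<noteq> 0 \<Longrightarrow> p \<in> B \<Longrightarrow> q \<in> B \<Longrightarrow> p \<noteq> q \<Longrightarrow>
      (\<And>x. x \<in> B \<Longrightarrow> c \<bullet> x \<le> c \<bullet> p) \<Longrightarrow> (\<And>x. x \<in> B \<Longrightarrow> c \<bullet> x \<le> c \<bullet> q) \<Longrightarrow>
      \<exists>a a'. a \<in> A \<and> a' \<in> A \<and> integral2 a \<and> integral2 a' \<and> a \<noteq> a' \<and>
        (\<forall>x\<in>A. c \<bullet> x \<le> c \<bullet> a) \<and> (\<forall>x\<in>A. c \<bullet> x \<le> c \<bullet> a')"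
    and ab: "a0 \<in> A" "b0 \<in> B" "integral2 (a0 + b0)"
  obtains a b where "a \<in> A" "b \<in> B" "integral2 a" "integral2 b" "a + b = a0 + b0"
proof (rule ccontr)
  assume neg: "\<not> thesis"
  define z where "z = a0 + b0"
  define K where "K = (\<lambda>x. z - x) ` A"
  have img: "(\<lambda>x. z - x) ` {x \<in> A. integral2 x} = {x \<in> K. integral2 x}"
  proof (intro equalityI subsetI)
    fix x assume "x \<in> {x \<in> K. integral2 x}"
    then obtain y where "y \<in> A" "x = z - y" "integral2 x" by (auto simp: K_def)
    moreover have "integral2 y" using integral2_diff[of z x] ab \<open>x = z - y\<close> \<open>integral2 x\<close> by (simp add: z_def)
    ultimately show "x \<in> (\<lambda>x. z - x) ` {x \<in> A. integral2 x}" by blast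
  qed (use ab in \<open>auto simp: K_def z_def intro: integral2_diff\<close>)
  have lin: "linear (\<lambda>x::real \<times> real. - x)" by (simp add: linear_uminus)
  have "K = (\<lambda>x. z + x) ` ((\<lambda>x. - x) ` (convex hull {x \<in> A. integral2 x}))"
    unfolding K_def A[symmetric] by (auto simp: image_image)
  also have "\<dots> = convex hull ((\<lambda>x. z - x) ` {x \<in> A. integral2 x})"
    by (simp add: convex_hull_linear_image[OF lin] flip: convex_hull_translation) (simp add: image_image)
  finally have K: "K = convex hull {x \<in> K. integral2 x}" by (simp add: img)
  interpret lattice_crossing K B
  proof
    show "convex K" using K by (metis convex_convex_hull)
    show "convex B" using B(1) by (metis convex_convex_hull)
    show "K \<subseteq> convex hull {x \<in> K. integral2 x}" using K by blast
    fix x assume xKB: "x \<in> K" "x \<in> B"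
    show "\<not> integral2 x"
    proof
      assume x: "integral2 x"
      obtain y where y: "y \<in> A" "x = z - y" using \<open>x \<in> K\<close> by (auto simp: K_def)
      then have "integral2 y" using integral2_diff[of z x] ab x by (simp add: z_def)
      then show False using neg that[OF y(1) xKB(2) _ x] y by (simp add: z_def)
    qed
  qed (rule B(2))
  show False
  proof (rule no_crossing[OF B(1)])
    show "b0 \<in> K" using ab(1) by (auto simp: K_def z_def image_iff intro!: bexI[of _ a0])
    show "b0 \<in> B" by fact
    fix p q assume pq: "p \<in> B" "q \<in> B" "p \<noteq> q" and le: "\<And>x. x \<in> B \<Longrightarrow> side p q x \<le> 0"
    define c where "c = (- snd (q - p), fst (q - p))"
    have c: "c \<bullet> x = side p q x + c \<bullet> p" for x
      by (simp add: c_def side_def cr_def inner_prod_def algebra_simps)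
    have sk: "side p q (z - k) = c \<bullet> z - c \<bullet> k - c \<bullet> p" for k
      using c[of "z - k"] by (simp add: inner_diff_right)
    have c0: "c \<noteq> 0" using pq(3) by (auto simp: c_def prod_eq_iff)
    have cB: "c \<bullet> x \<le> c \<bullet> p" "c \<bullet> x \<le> c \<bullet> q" if "x \<in> B" for x
      using le[OF that] c[of x] c[of q] by simp_all
    obtain a a' where a: "a \<in> A" "a' \<in> A" "integral2 a" "integral2 a'" "a \<noteq> a'"
        "\<forall>x\<in>A. c \<bullet> x \<le> c \<bullet> a" "\<forall>x\<in>A. c \<bullet> x \<le> c \<bullet> a'"
      using edges[OF c0 pq cB] by blast
    show "\<exists>x x'. x \<in> K \<and> x' \<in> K \<and> integral2 x \<and> integral2 x' \<and> x \<noteq> x' \<and> 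
        (\<forall>k\<in>K. side p q x \<le> side p q k) \<and> (\<forall>k\<in>K. side p q x' \<le> side p q k)"
    proof (intro exI conjI)
      show "z - a \<in> K" "z - a' \<in> K" using a by (auto simp: K_def)
      show "integral2 (z - a)" "integral2 (z - a')" using a ab by (auto simp: z_def intro: integral2_diff)
      show "z - a \<noteq> z - a'" using a by simp
      show "\<forall>k\<in>K. side p q (z - a) \<le> side p q k" "\<forall>k\<in>K. side p q (z - a') \<le> side p q k"
        using a(6,7) by (auto simp: K_def sk)
    qed
  qed
qed

section \<open>Vertices and slices of polytopes\<close>

lemma lattice_pt_add: "lattice_pt x \<Longrightarrow> lattice_pt y \<Longrightarrow> lattice_pt (x + y)"
  and lattice_pt_diff: "lattice_pt x \<Longrightarrow> lattice_pt y \<Longrightarrow> lattice_pt (x - y)"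
  and lattice_pt_scale: "k \<in> \<int> \<Longrightarrow> lattice_pt x \<Longrightarrow> lattice_pt (k *\<^sub>R x)"
  by (auto simp: lattice_pt_def)

lemma finite_lattice_pts:
  assumes "bounded X"
  shows "finite {x \<in> X. lattice_pt x}"
proof -
  obtain B where B: "\<And>x. x \<in> X \<Longrightarrow> norm x \<le> B" using assms by (auto simp: bounded_iff)
  define N where "N = {k. of_int k \<in> {- B..B}}"
  have "finite N"
  proof (rule finite_subset)
    show "N \<subseteq> {\<lceil>- B\<rceil>..\<lfloor>B\<rfloor>}" by (auto simp: N_def ceiling_le_iff le_floor_iff)
  qed simp
  have "{x \<in> X. lattice_pt x} \<subseteq> (\<lambda>f. \<chi> i. of_int (f i)) ` (PiE UNIV (\<lambda>_. N))"
  proof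
    fix x assume x: "x \<in> {x \<in> X. lattice_pt x}"
    define f where "f i = \<lfloor>x $ i\<rfloor>" for i
    have f: "of_int (f i) = x $ i" for i
      using x unfolding f_def lattice_pt_def by (auto elim!: Ints_cases)
    have "\<bar>x $ i\<bar> \<le> B" for i using component_le_norm_cart[of x i] B[of x] x by force
    then have "f i \<in> N" for i using abs_le_D1[of "x $ i" B] abs_le_D2[of "x $ i" B] by (auto simp: N_def f)
    then have "f \<in> PiE UNIV (\<lambda>_. N)" by auto
    moreover have "x = (\<chi> i. of_int (f i))" by (simp add: vec_eq_iff f)
    ultimately show "x \<in> (\<lambda>f. \<chi> i. of_int (f i)) ` (PiE UNIV (\<lambda>_. N))" by blast
  qed
  moreover have "finite (PiE (UNIV :: 3 set) (\<lambda>_. N))" using \<open>finite N\<close> by (intro finite_PiE) auto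
  ultimately show ?thesis by (meson finite_imageI finite_subset)
qed

lemma edge_of_segment:
  fixes P :: "'a::euclidean_space set"
  assumes "polytope P" "E edge_of P"
  obtains a b where "a \<noteq> b" "E = closed_segment a b" "a extreme_point_of P" "b extreme_point_of P"
proof -
  have E: "E face_of P" "aff_dim E = 1" using assms(2) by (auto simp: edge_of_def)
  have "polytope E" using assms(1) E face_of_polytope_polytope by blast
  then have "compact E" "convex E" by (auto simp: polytope_imp_compact polytope_imp_convex)
  moreover have "E \<noteq> {}" using E by auto
  moreover have "collinear E" using E by (simp add: collinear_aff_dim)
  ultimately obtain a b where ab: "E = closed_segment a b"
    using compact_convex_collinear_segment by blast
  then have "a \<noteq> b" using E by auto
  moreover have "a extreme_point_of E" "b extreme_point_of E"
    unfolding ab extreme_point_of_segment by auto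
  ultimately show thesis using that ab extreme_point_of_face[OF E(1)] by blast
qed

lemma in_open_segment_symmetric:
  fixes x w :: "'a::euclidean_space"
  assumes "w \<noteq> 0"
  shows "x \<in> open_segment (x - w) (x + w)"
proof -
  have "x - w + (x + w) = 2 *\<^sub>R x" by (simp add: scaleR_2)
  then have m: "midpoint (x - w) (x + w) = x" by (simp add: midpoint_def)
  then have "x - w \<noteq> x + w" using assms by (metis add_cancel_right_right midpoint_idem)
  then show ?thesis using midpoint_in_open_segment[of "x - w" "x + w"] m by simp
qed

text \<open>Let \<open>E\<close> be the smallest face containing \<open>x\<close>, so that
  \<open>x\<close> is in its relative interior. A second common point of the hyperplane and the
  affine hull of \<open>E\<close> would allow moving \<open>x\<close> both ways inside the slice. So
  they meet only in \<open>x\<close> and \<open>E\<close> has dimension at most 1; dimension 0 would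
  make \<open>x\<close> a vertex.\<close>

lemma slice_extreme:
  fixes P :: "'a::euclidean_space set"
  assumes P: "polytope P" and x: "x extreme_point_of (P \<inter> {y. h \<bullet> y = s})"
    and nx: "\<not> x extreme_point_of P"
  obtains a b where "closed_segment a b edge_of P" "a extreme_point_of P" "b extreme_point_of P"
    "x \<in> closed_segment a b" "h \<bullet> a < s" "s < h \<bullet> b"
proof -
  have xP: "x \<in> P" "h \<bullet> x = s" using x by (auto simp: extreme_point_of_def)
  define \<F> where "\<F> = {F. F face_of P \<and> x \<in> F}"
  have "finite \<F>" using finite_polytope_faces[OF P] by (rule finite_subset[rotated]) (auto simp: \<F>_def)
  moreover have "P \<in> \<F>" using xP P by (auto simp: \<F>_def face_of_refl polytope_imp_convex)
  ultimately obtain E where E: "E \<in> \<F>" and Emin: "\<And>F. F \<in> \<F> \<Longrightarrow> F \<subseteq> E \<Longrightarrow> F = E"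
    using finite_has_minimal[of \<F>] by (metis empty_iff)
  have EP: "E face_of P" "x \<in> E" using E by (auto simp: \<F>_def)
  have Epoly: "polytope E" using P EP face_of_polytope_polytope by blast
  have rel: "x \<in> rel_interior E"
  proof (rule ccontr)
    assume "x \<notin> rel_interior E"
    then have "x \<in> rel_frontier E"
      using EP Epoly by (simp add: rel_frontier_def polytope_imp_closed)
    then obtain F where F: "F facet_of E" "x \<in> F"
      using rel_frontier_of_polyhedron[OF polytope_imp_polyhedron[OF Epoly]] by blast
    then have "F face_of P" using EP face_of_trans facet_of_imp_face_of by blast
    then have "F = E" using Emin F facet_of_imp_subset by (auto simp: \<F>_def)
    then show False using F by simp
  qed
  have inE: "y = x" if y: "y \<in> affine hull E" "h \<bullet> y = s" for y
  proof (rule ccontr)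
    assume "y \<noteq> x"
    obtain e where e: "e > 0" "cball x e \<inter> affine hull E \<subseteq> E"
      using rel by (auto simp: mem_rel_interior_cball)
    define r where "r = e / norm (y - x)"
    have r: "r > 0" using e \<open>y \<noteq> x\<close> by (simp add: r_def)
    have mem: "x + k *\<^sub>R (y - x) \<in> P \<inter> {y. h \<bullet> y = s}" if "\<bar>k\<bar> = r" for k
    proof -
      have "(1 - k) *\<^sub>R x + k *\<^sub>R y \<in> affine hull E"
        using EP hull_subset[of E affine] y affine_affine_hull[of E] unfolding affine_def by force
      then have "x + k *\<^sub>R (y - x) \<in> affine hull E" by (simp add: algebra_simps)
      moreover have "norm (k *\<^sub>R (y - x)) = e" using that \<open>y \<noteq> x\<close> by (simp add: r_def)
      then have "x + k *\<^sub>R (y - x) \<in> cball x e" by (simp add: mem_cball dist_norm)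
      ultimately have "x + k *\<^sub>R (y - x) \<in> P" using e EP face_of_imp_subset by blast
      then show ?thesis using y xP by (simp add: inner_add_right inner_diff_right)
    qed
    have "x \<in> open_segment (x - r *\<^sub>R (y - x)) (x + r *\<^sub>R (y - x))"
      using r \<open>y \<noteq> x\<close> by (intro in_open_segment_symmetric) simp
    then show False using x mem[of r] mem[of "- r"] r unfolding extreme_point_of_def by auto
  qed
  have "aff_dim (affine hull E \<inter> {y. h \<bullet> y = s}) \<le> 0"
  proof -
    have "affine hull E \<inter> {y. h \<bullet> y = s} \<subseteq> {x}" using inE by blast
    from aff_dim_subset[OF this] show ?thesis by simp
  qed
  moreover have "x \<in> affine hull E \<inter> {y. h \<bullet> y = s}" using EP xP hull_subset[of E affine] by auto
  ultimately have "aff_dim E \<le> 1"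
    using aff_dim_affine_Int_hyperplane[of "affine hull E" h s] affine_affine_hull[of E]
    by (auto split: if_splits)
  moreover have "aff_dim E \<noteq> 0"
  proof
    assume "aff_dim E = 0"
    then obtain y where "E = {y}" using aff_dim_eq_0[of E] by blast
    then have "E = {x}" using EP(2) by simp
    then show False using EP(1) nx by (simp add: face_of_singleton)
  qed
  moreover have "aff_dim E \<noteq> -1" using EP(2) aff_dim_empty[of E] by blast
  moreover have "aff_dim E \<ge> -1" by (rule aff_dim_geq)
  ultimately have "aff_dim E = 1" by linarith
  then have edge: "E edge_of P" using EP by (simp add: edge_of_def)
  then obtain a b where ab: "a \<noteq> b" "E = closed_segment a b" "a extreme_point_of P" "b extreme_point_of P"
    using edge_of_segment[OF P] by blast
  obtain t where t: "0 \<le> t" "t \<le> 1" "x = (1 - t) *\<^sub>R a + t *\<^sub>R b"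
    using EP ab by (auto simp: in_segment)
  have "t \<noteq> 0" "t \<noteq> 1" using t ab nx by auto
  then have t01: "0 < t" "t < 1" using t by auto
  have hs: "s = (1 - t) * (h \<bullet> a) + t * (h \<bullet> b)" using xP t by (simp add: inner_add_right)
  have ne: "h \<bullet> a \<noteq> s"
  proof
    assume "h \<bullet> a = s"
    moreover have "a \<in> affine hull E" using ab hull_subset[of E affine] by auto
    ultimately have "a = x" by (rule inE[rotated])
    then show False using ab nx by simp
  qed
  have "s - h \<bullet> a = t * (h \<bullet> b - h \<bullet> a)" "h \<bullet> b - s = (1 - t) * (h \<bullet> b - h \<bullet> a)"
    unfolding hs by (simp_all add: algebra_simps)
  moreover have "h \<bullet> b - h \<bullet> a \<noteq> 0" using calculation(1) ne by auto
  then have "0 < h \<bullet> b - h \<bullet> a \<or> h \<bullet> b - h \<bullet> a < 0" by arith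
  ultimately have "h \<bullet> a < s \<and> s < h \<bullet> b \<or> h \<bullet> b < s \<and> s < h \<bullet> a"
    using t01 mult_pos_pos[of t "h \<bullet> b - h \<bullet> a"] mult_pos_pos[of "1 - t" "h \<bullet> b - h \<bullet> a"]
      mult_pos_neg[of t "h \<bullet> b - h \<bullet> a"] mult_pos_neg[of "1 - t" "h \<bullet> b - h \<bullet> a"] by linarith
  then consider "h \<bullet> a < s" "s < h \<bullet> b" | "h \<bullet> b < s" "s < h \<bullet> a" by blast
  then show thesis
  proof cases
    case 1 then show ?thesis using that[of a b] ab edge EP by auto
  next
    case 2 then show ?thesis using that[of b a] ab edge EP by (simp add: closed_segment_commute)
  qed
qed

text \<open>A linear functional that does not decrease along the edges at a vertex is minimal there:
  pass to the vertex figure, whose extreme points lie on these edges.\<close>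

lemma edge_local_min:
  fixes P :: "'a::euclidean_space set"
  assumes P: "polytope P" and v: "v extreme_point_of P"
    and edges: "\<And>b. closed_segment v b edge_of P \<Longrightarrow> n \<bullet> v \<le> n \<bullet> b"
    and x: "x \<in> P"
  shows "n \<bullet> v \<le> n \<bullet> x"
proof -
  have vP: "v \<in> P" using v by (simp add: extreme_point_of_def)
  have "{v} exposed_face_of P"
    using exposed_face_of_polyhedron[OF polytope_imp_polyhedron[OF P]] v face_of_singleton by blast
  then obtain a b where ab: "P \<subseteq> {x. a \<bullet> x \<le> b}" "{v} = P \<inter> {x. a \<bullet> x = b}"
    unfolding exposed_face_of_def by blast
  define h where "h = - a"
  have h: "h \<bullet> v < h \<bullet> y" if "y \<in> P" "y \<noteq> v" for y
  proof -
    have "a \<bullet> v = b" "a \<bullet> y \<le> b" "a \<bullet> y \<noteq> b" using that ab by auto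
    then show ?thesis by (simp add: h_def)
  qed
  define W where "W = {w. w extreme_point_of P} - {v}"
  have "finite W" unfolding W_def using finite_polyhedron_extreme_points[OF polytope_imp_polyhedron[OF P]] by simp
  have WP: "w \<in> P" "w \<noteq> v" if "w \<in> W" for w using that by (auto simp: W_def extreme_point_of_def)
  have nW: "n \<bullet> v \<le> n \<bullet> w" if w: "w \<in> W" for w
  proof -
    define m where "m = Min ((\<bullet>) h ` W)"
    have m: "h \<bullet> v < m" "\<And>w'. w' \<in> W \<Longrightarrow> m \<le> h \<bullet> w'"
    proof -
      have "finite ((\<bullet>) h ` W)" "(\<bullet>) h ` W \<noteq> {}" using \<open>finite W\<close> w by auto
      then show "h \<bullet> v < m" "\<And>w'. w' \<in> W \<Longrightarrow> m \<le> h \<bullet> w'" using h WP by (auto simp: m_def)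
    qed
    \<comment> \<open>A height strictly between \<open>v\<close> and all other vertices, so every
      edge that crosses it starts at \<open>v\<close>.\<close>
    define s where "s = (h \<bullet> v + m) / 2"
    have "h \<bullet> v < s" "s < m" using m(1) by (simp_all add: s_def)
    then have s: "h \<bullet> v < s" "\<And>w'. w' \<in> W \<Longrightarrow> s < h \<bullet> w'" using m(2) by (auto intro: less_le_trans)
    define S where "S = P \<inter> {y. h \<bullet> y = s}"
    have "polytope S" unfolding S_def using P by (simp add: polytope_Int_polyhedron polyhedron_hyperplane)
    then have S: "compact S" "convex S" by (auto simp: polytope_imp_compact polytope_imp_convex)
    have "n \<bullet> v \<le> n \<bullet> z" if z: "z extreme_point_of S" for z
    proof -
      have "h \<bullet> z = s" using z by (auto simp: S_def extreme_point_of_def)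
      then have "\<not> z extreme_point_of P" using s(1) s(2)[of z] by (auto simp: W_def)
      then obtain a b where ab: "closed_segment a b edge_of P" "a extreme_point_of P" "b extreme_point_of P"
        "z \<in> closed_segment a b" "h \<bullet> a < s" "s < h \<bullet> b"
        by (rule slice_extreme[OF P z[unfolded S_def]])
      then have "a = v" using s(2)[of a] by (auto simp: W_def)
      then have "n \<bullet> v \<le> n \<bullet> b" using edges ab by blast
      moreover obtain t where t: "0 \<le> t" "t \<le> 1" "z = (1 - t) *\<^sub>R v + t *\<^sub>R b"
        using ab \<open>a = v\<close> by (auto simp: in_segment)
      ultimately have "0 \<le> t * (n \<bullet> b - n \<bullet> v)" by simp
      moreover have "n \<bullet> z = n \<bullet> v + t * (n \<bullet> b - n \<bullet> v)"
        unfolding t(3) by (simp add: inner_add_right algebra_simps)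
      ultimately show ?thesis by linarith
    qed
    then have "{z. z extreme_point_of S} \<subseteq> {z. n \<bullet> z \<ge> n \<bullet> v}" by blast
    then have "convex hull {z. z extreme_point_of S} \<subseteq> {z. n \<bullet> z \<ge> n \<bullet> v}"
      by (rule hull_minimal) (rule convex_halfspace_ge)
    then have "S \<subseteq> {z. n \<bullet> z \<ge> n \<bullet> v}" by (rule ord_eq_le_trans[OF Krein_Milman_Minkowski[OF S]])
    moreover define t where "t = (s - h \<bullet> v) / (h \<bullet> w - h \<bullet> v)"
    have t: "0 < t" "t \<le> 1" using s(1) s(2)[OF w] by (simp_all add: t_def)
    have "t * (h \<bullet> w - h \<bullet> v) = s - h \<bullet> v" using s(1) s(2)[OF w] by (simp add: t_def)
    then have "(1 - t) *\<^sub>R v + t *\<^sub>R w \<in> S"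
      using vP WP[OF w] t polytope_imp_convex[OF P]
      by (auto simp: S_def convex_alt inner_add_right algebra_simps)
    ultimately have "n \<bullet> v \<le> n \<bullet> ((1 - t) *\<^sub>R v + t *\<^sub>R w)" by blast
    then have "0 \<le> t * (n \<bullet> w - n \<bullet> v)" by (simp add: inner_add_right algebra_simps)
    then show ?thesis using t by (simp add: zero_le_mult_iff)
  qed
  have "{w. w extreme_point_of P} \<subseteq> {z. n \<bullet> z \<ge> n \<bullet> v}" using nW by (auto simp: W_def)
  then have "convex hull {w. w extreme_point_of P} \<subseteq> {z. n \<bullet> z \<ge> n \<bullet> v}"
    by (rule hull_minimal) (rule convex_halfspace_ge)
  then have "P \<subseteq> {z. n \<bullet> z \<ge> n \<bullet> v}"
    by (rule ord_eq_le_trans[OF Krein_Milman_Minkowski[OF polytope_imp_compact[OF P] polytope_imp_convex[OF P]]])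
  then show ?thesis using x by blast
qed

section \<open>Dual bases and the edge frame at a smooth vertex\<close>

definition dual_basis :: "(real^3) set \<Rightarrow> (real^3 \<Rightarrow> real^3) \<Rightarrow> bool" where
  "dual_basis U n \<longleftrightarrow> finite U \<and> card U = 3 \<and> (\<forall>u\<in>U. lattice_pt u) \<and>
     (\<forall>u\<in>U. \<forall>u'\<in>U. n u \<bullet> u' = (if u = u' then 1 else 0)) \<and>
     (\<forall>x. x = (\<Sum>u\<in>U. (n u \<bullet> x) *\<^sub>R u)) \<and>
     (\<forall>x. lattice_pt x \<longrightarrow> (\<forall>u\<in>U. n u \<bullet> x \<in> \<int>))"

lemma dual_basisD:
  assumes "dual_basis U n"
  shows "finite U" "card U = 3" "\<And>u. u \<in> U \<Longrightarrow> lattice_pt u"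
    "\<And>u u'. u \<in> U \<Longrightarrow> u' \<in> U \<Longrightarrow> n u \<bullet> u' = (if u = u' then 1 else 0)"
    "\<And>x. x = (\<Sum>u\<in>U. (n u \<bullet> x) *\<^sub>R u)"
    "\<And>x u. lattice_pt x \<Longrightarrow> u \<in> U \<Longrightarrow> n u \<bullet> x \<in> \<int>"
  using assms unfolding dual_basis_def by (blast+)

lemma lattice_basis_dual:
  assumes U: "lattice_basis U"
  obtains n where "dual_basis U n"
proof -
  have ind: "independent U" using U by (simp add: lattice_basis_def)
  have fin: "finite U" using ind by (rule independent_imp_finite)
  have "Basis \<subseteq> span U"
  proof
    fix b :: "real^3" assume "b \<in> Basis"
    then have "lattice_pt b" by (auto simp: lattice_pt_def Basis_vec_def axis_def)
    then obtain c where "b = (\<Sum>u\<in>U. c u *\<^sub>R u)" using U unfolding lattice_basis_def by blast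
    then show "b \<in> span U" by (auto intro: span_sum span_scale span_base)
  qed
  then have span: "span U = UNIV" by (metis span_Basis span_minimal subspace_span top.extremum_uniqueI)
  have card: "card U = 3" using dim_eq_card[OF _ ind, of UNIV] span by (simp add: dim_UNIV)
  \<comment> \<open>The adjoint at 1 turns the coordinate functional at \<open>u\<close> into a
    vector.\<close>
  define n where "n u = adjoint (\<lambda>x. representation U x u) 1" for u
  have lin: "linear (\<lambda>x. representation U x u)" for u
    by (intro linearI) (simp_all add: representation_add[OF ind] representation_scale[OF ind] span)
  have n: "n u \<bullet> x = representation U x u" for u x
    using adjoint_works[OF lin, of x u 1] by (simp add: n_def inner_commute)
  show thesis
  proof (rule that, unfold dual_basis_def, intro conjI ballI allI impI)
    show "n u \<bullet> u' = (if u = u' then 1 else 0)" if "u \<in> U" "u' \<in> U" for u u'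
      using that by (simp add: n representation_basis[OF ind])
    show "x = (\<Sum>u\<in>U. (n u \<bullet> x) *\<^sub>R u)" for x
      unfolding n by (rule sum_representation_eq[OF ind _ fin order_refl, symmetric]) (simp add: span)
    show "n u \<bullet> x \<in> \<int>" if x: "lattice_pt x" "u \<in> U" for x u
    proof -
      obtain c where c: "\<forall>u\<in>U. c u \<in> \<int>" "x = (\<Sum>u\<in>U. c u *\<^sub>R u)"
        using U x unfolding lattice_basis_def by blast
      have "n u \<bullet> x = (\<Sum>u'\<in>U. c u' * (n u \<bullet> u'))" unfolding c(2) by (simp add: inner_sum_right)
      also have "\<dots> = (\<Sum>u'\<in>U. if u = u' then c u' else 0)"
        by (intro sum.cong) (use x in \<open>auto simp: n representation_basis[OF ind]\<close>)
      also have "\<dots> = c u" using fin x by simp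
      finally show ?thesis using c x by simp
    qed
  qed (use fin card U in \<open>auto simp: lattice_basis_def\<close>)
qed

text \<open>Squared norms of lattice points are natural numbers, so a shortest one exists.\<close>

lemma lattice_norm_least:
  assumes "lattice_pt u0" "Q u0"
  obtains u where "lattice_pt u" "Q u" "\<forall>u'. lattice_pt u' \<and> Q u' \<longrightarrow> norm u \<le> norm u'"
proof -
  define f where "f u = nat \<lfloor>(norm u)\<^sup>2\<rfloor>" for u :: "real^3"
  have f: "real (f u) = (norm u)\<^sup>2" if "lattice_pt u" for u
  proof -
    have "(norm u)\<^sup>2 = (\<Sum>i\<in>UNIV. (u $ i)\<^sup>2)"
      by (simp add: norm_vec_def L2_set_def sum_nonneg)
    also have "\<dots> \<in> \<int>" using that by (auto simp: lattice_pt_def)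
    finally obtain k where k: "(norm u)\<^sup>2 = of_int k" by (rule Ints_cases)
    then have "0 \<le> k" by (metis of_int_0_le_iff zero_le_power2)
    then show ?thesis using k by (simp add: f_def)
  qed
  obtain u where u: "lattice_pt u \<and> Q u" "\<forall>u'. lattice_pt u' \<and> Q u' \<longrightarrow> f u \<le> f u'"
    using ex_has_least_nat[of "\<lambda>u. lattice_pt u \<and> Q u" u0 f] assms by blast
  have "norm u \<le> norm u'" if "lattice_pt u'" "Q u'" for u'
  proof -
    have "real (f u) \<le> real (f u')" using u that by simp
    then have "(norm u)\<^sup>2 \<le> (norm u')\<^sup>2" using f u that by simp
    then show ?thesis by (simp add: power2_le_iff_abs_le)
  qed
  then show thesis using that u by blast
qed

text \<open>\<open>b - v\<close> is itself a lattice vector along the edge, so the shortest one is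
  not longer; hence the factor is at least 1, and \<open>v + u\<close> stays on the edge.\<close>

lemma prim_edge_dir_segment:
  assumes "lattice_pt v" "lattice_pt b" "v \<noteq> b" and u: "prim_edge_dir v (closed_segment v b) u"
  obtains k where "k \<ge> 1" "b = v + k *\<^sub>R u"
proof -
  have u0: "u \<noteq> 0" using u by (simp add: prim_edge_dir_def)
  obtain t where t: "t > 0" "v + t *\<^sub>R u \<in> closed_segment v b" using u by (auto simp: prim_edge_dir_def)
  then obtain r where r: "0 \<le> r" "r \<le> 1" "v + t *\<^sub>R u = (1 - r) *\<^sub>R v + r *\<^sub>R b" by (auto simp: in_segment)
  then have e: "t *\<^sub>R u = r *\<^sub>R (b - v)" by (simp add: algebra_simps)
  then have "r > 0" using r t u0 by (cases "r = 0") auto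
  have "(1 / r) *\<^sub>R (t *\<^sub>R u) = b - v" unfolding e using \<open>r > 0\<close> by simp
  then have b: "b - v = (t / r) *\<^sub>R u" by simp
  have "v + 1 *\<^sub>R (b - v) \<in> closed_segment v b" by simp
  then have "norm u \<le> norm (b - v)"
    using u assms(1-3) lattice_pt_diff[of b v] unfolding prim_edge_dir_def
    by (metis right_minus_eq zero_less_one)
  then have "1 * norm u \<le> (t / r) * norm u" unfolding b using t \<open>r > 0\<close> by simp
  then have "t / r \<ge> 1" by (rule mult_right_le_imp_le) (use u0 in simp)
  then show thesis using that b by (metis add_diff_cancel_left' diff_add_cancel add.commute)
qed

lemma prim_edge_dir_exists:
  assumes "lattice_pt v" "lattice_pt b" "v \<noteq> b"
  obtains u where "prim_edge_dir v (closed_segment v b) u"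
proof -
  let ?Q = "\<lambda>u. u \<noteq> 0 \<and> (\<exists>t>0. v + t *\<^sub>R u \<in> closed_segment v b)"
  have "?Q (b - v)" using assms(3) by (auto intro!: exI[of _ 1])
  then obtain u where "lattice_pt u" "?Q u" "\<forall>u'. lattice_pt u' \<and> ?Q u' \<longrightarrow> norm u \<le> norm u'"
    using lattice_norm_least[of "b - v" ?Q, OF lattice_pt_diff[OF assms(2,1)]] by blast
  then have "prim_edge_dir v (closed_segment v b) u" unfolding prim_edge_dir_def by blast
  then show thesis by (rule that)
qed

lemma smooth_polytope3D:
  assumes "smooth_polytope3 P"
  shows "polytope P" "aff_dim P = 3" "\<And>v. v extreme_point_of P \<Longrightarrow> lattice_pt v"
    "\<And>v. v extreme_point_of P \<Longrightarrow> lattice_basis (prim_edge_dirs P v)"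
proof -
  show "polytope P" "aff_dim P = 3" "\<And>v. v extreme_point_of P \<Longrightarrow> lattice_basis (prim_edge_dirs P v)"
    using assms by (auto simp: smooth_polytope3_def simple_polytope3_def)
  show "lattice_pt v" if "v extreme_point_of P" for v
    using assms that extreme_point_of_convex_hull unfolding smooth_polytope3_def lattice_polytope_def by metis
qed

text \<open>The vectors \<open>n u\<close> are the dual basis: the tangent cone at the vertex is where all of them
  are nonnegative.\<close>

lemma smooth_vertex:
  assumes P: "smooth_polytope3 P" and v: "v extreme_point_of P"
  obtains U n where "dual_basis U n" "\<forall>u\<in>U. v + u \<in> P"
    "\<forall>u\<in>U. \<forall>x\<in>P. 0 \<le> n u \<bullet> (x - v)"
    "\<forall>b. closed_segment v b edge_of P \<longrightarrow> (\<exists>u\<in>U. \<exists>k>0. b = v + k *\<^sub>R u)"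
proof -
  note PD = smooth_polytope3D[OF P]
  define U where "U = prim_edge_dirs P v"
  have basis: "lattice_basis U" unfolding U_def using PD(4)[OF v] .
  obtain n where n: "dual_basis U n" using lattice_basis_dual[OF basis] by blast
  have seg: "\<exists>u\<in>U. \<exists>k>0. b = v + k *\<^sub>R u" if b: "closed_segment v b edge_of P" for b
  proof -
    have "b \<noteq> v" using b by (auto simp: edge_of_def)
    moreover have "b extreme_point_of P"
      using b extreme_point_of_face[of "closed_segment v b" P b] by (simp add: edge_of_def extreme_point_of_segment)
    ultimately obtain u where u: "prim_edge_dir v (closed_segment v b) u"
      using prim_edge_dir_exists PD(3) v by metis
    then have "u \<in> U" unfolding U_def prim_edge_dirs_def using b by auto
    moreover obtain k where "k \<ge> 1" "b = v + k *\<^sub>R u"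
      using prim_edge_dir_segment[OF _ _ _ u] PD(3) v \<open>b \<noteq> v\<close> \<open>b extreme_point_of P\<close> by metis
    ultimately show ?thesis by (metis less_le_trans zero_less_one)
  qed
  show thesis
  proof (rule that[OF n], safe)
    show "v + u \<in> P" if u: "u \<in> U" for u
    proof -
      obtain E where E: "E edge_of P" "v \<in> E" "prim_edge_dir v E u"
        using u by (auto simp: U_def prim_edge_dirs_def)
      obtain a b where ab: "a \<noteq> b" "E = closed_segment a b" "a extreme_point_of P" "b extreme_point_of P"
        using edge_of_segment[OF PD(1) E(1)] by blast
      have "v extreme_point_of E" using v E extreme_point_of_face[of E P v] by (simp add: edge_of_def)
      then have "v = a \<or> v = b" unfolding ab extreme_point_of_segment .
      then obtain c where c: "E = closed_segment v c" "c \<noteq> v" "c extreme_point_of P"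
        using ab closed_segment_commute by metis
      obtain k where k: "k \<ge> 1" "c = v + k *\<^sub>R u"
        using prim_edge_dir_segment[of v c u] E c PD(3) v by metis
      have "v + u = (1 - 1 / k) *\<^sub>R v + (1 / k) *\<^sub>R c" unfolding k(2) using k(1) by (simp add: algebra_simps)
      then have "v + u \<in> E" unfolding c in_segment using k(1) by (intro exI[of _ "1 / k"]) auto
      then show ?thesis using E edge_of_imp_subset by blast
    qed
    show "0 \<le> n u \<bullet> (x - v)" if "u \<in> U" "x \<in> P" for u x
    proof -
      have "n u \<bullet> v \<le> n u \<bullet> b" if b: "closed_segment v b edge_of P" for b
        using seg[OF b] dual_basisD(4)[OF n] \<open>u \<in> U\<close> by (auto simp: inner_add_right)
      then show ?thesis using edge_local_min[OF PD(1) v _ \<open>x \<in> P\<close>, of "n u"] by (simp add: inner_diff_right)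
    qed
  qed (use seg in blast)
qed

section \<open>The normal fan of a prismatoid\<close>

definition maxface :: "(real^3) set \<Rightarrow> real^3 \<Rightarrow> (real^3) set" where
  "maxface P c = {x \<in> P. \<forall>y\<in>P. c \<bullet> y \<le> c \<bullet> x}"

lemma maxfaceD: "x \<in> maxface P c \<Longrightarrow> x \<in> P" "x \<in> maxface P c \<Longrightarrow> y \<in> P \<Longrightarrow> c \<bullet> y \<le> c \<bullet> x"
  by (auto simp: maxface_def)

lemma maxface_eqI: "x \<in> maxface P c \<Longrightarrow> y \<in> P \<Longrightarrow> c \<bullet> x \<le> c \<bullet> y \<Longrightarrow> y \<in> maxface P c"
  by (auto simp: maxface_def intro: order_trans)

lemma maxface_eq: "x \<in> maxface P c \<Longrightarrow> y \<in> maxface P c \<Longrightarrow> c \<bullet> x = c \<bullet> y"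
  by (simp add: maxface_def order_antisym)

lemma maxface_face:
  assumes "convex P" shows "maxface P c face_of P"
proof (cases "maxface P c = {}")
  case False
  then obtain x where x: "x \<in> maxface P c" by blast
  have "maxface P c = P \<inter> {y. c \<bullet> y = c \<bullet> x}"
    using x by (auto simp: maxface_def order_antisym)
  moreover have "(P \<inter> {y. c \<bullet> y = c \<bullet> x}) face_of P"
    using assms maxfaceD(2)[OF x] by (intro face_of_Int_supporting_hyperplane_le) auto
  ultimately show ?thesis by simp
qed simp

lemma maxface_nonempty:
  assumes "compact P" "P \<noteq> {}" shows "maxface P c \<noteq> {}"
proof -
  have "continuous_on P (\<lambda>x. c \<bullet> x)" by (intro continuous_intros)
  then show ?thesis using continuous_attains_sup[OF assms] by (auto simp: maxface_def)
qed

lemma face_extreme_point: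
  fixes P :: "'a::euclidean_space set"
  assumes "polytope P" "F face_of P" "F \<noteq> {}"
  obtains v where "v extreme_point_of P" "v \<in> F"
proof -
  have "compact F" "convex F"
    using assms face_of_polytope_polytope polytope_imp_compact polytope_imp_convex by blast+
  then obtain v where "v extreme_point_of F" using extreme_point_exists_convex assms(3) by blast
  then show thesis using that extreme_point_of_face[OF assms(2)] by blast
qed

lemma normal_cone_maxface: "F \<subseteq> P \<Longrightarrow> c \<in> normal_cone P F \<longleftrightarrow> F \<subseteq> maxface P c"
  by (auto simp: normal_cone_def maxface_def)

text \<open>A fan records cones, not faces: the counterpart of \<open>F\<close> is some
  \<open>G\<close> maximized by exactly the same functionals.\<close>

lemma normal_fan_face:
  assumes "normal_fan P = normal_fan P'" "F face_of P" "F \<noteq> {}"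
  obtains G where "G \<noteq> {}" "\<forall>c. F \<subseteq> maxface P c \<longleftrightarrow> G \<subseteq> maxface P' c"
proof -
  have "normal_cone P F \<in> normal_fan P'" using assms unfolding normal_fan_def by blast
  then obtain G where G: "G face_of P'" "G \<noteq> {}" "normal_cone P F = normal_cone P' G"
    unfolding normal_fan_def by blast
  then show thesis using that[of G] normal_cone_maxface[of F P] normal_cone_maxface[of G P']
      face_of_imp_subset[OF G(1)] face_of_imp_subset[OF assms(2)] by blast
qed

text \<open>A common maximizer means that \<open>c\<close> and \<open>d\<close> lie in the normal
  cone of one nonempty face, and this cone occurs in the fan of \<open>P'\<close> too.\<close>

lemma normal_fan_maxface_Int:
  assumes "normal_fan P = normal_fan P'" "convex P" "maxface P c \<inter> maxface P d \<noteq> {}"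
  shows "maxface P' c \<inter> maxface P' d \<noteq> {}"
proof -
  have face: "(maxface P c \<inter> maxface P d) face_of P" using assms(2) by (intro face_of_Int maxface_face)
  obtain G where G: "G \<noteq> {}"
    "\<forall>e. maxface P c \<inter> maxface P d \<subseteq> maxface P e \<longleftrightarrow> G \<subseteq> maxface P' e"
    by (rule normal_fan_face[OF assms(1) face assms(3)])
  have "G \<subseteq> maxface P' c" "G \<subseteq> maxface P' d" using G(2)[THEN spec, of c] G(2)[THEN spec, of d] by auto
  then show ?thesis using G(1) by auto
qed

lemma normal_fan_maxface_mono:
  assumes "normal_fan P = normal_fan P'" "convex P" "compact P" "P \<noteq> {}"
    and "maxface P' c \<subseteq> maxface P' d"
  shows "maxface P c \<subseteq> maxface P d"
proof -
  obtain G where "G \<noteq> {}" and G: "\<forall>e. maxface P c \<subseteq> maxface P e \<longleftrightarrow> G \<subseteq> maxface P' e"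
    by (rule normal_fan_face[OF assms(1) maxface_face[OF assms(2)] maxface_nonempty[OF assms(3,4)]])
  have "G \<subseteq> maxface P' c" using G[THEN spec, of c] by simp
  then have "G \<subseteq> maxface P' d" using assms(5) by simp
  then show ?thesis using G[THEN spec, of d] by simp
qed

text \<open>The prismatoid structure as seen by the normal fan alone: \<open>w\<close> and \<open>-w\<close> span rays of the fan,
  and every maximal cone contains one of them.\<close>

definition prismlike :: "(real^3) set \<Rightarrow> real^3 \<Rightarrow> bool" where
  "prismlike P w \<longleftrightarrow> w \<noteq> 0 \<and>
     (\<forall>v. v extreme_point_of P \<longrightarrow> v \<in> maxface P w \<or> v \<in> maxface P (- w)) \<and>
     (\<forall>c. maxface P w \<subseteq> maxface P c \<longrightarrow> (\<exists>k. c = k *\<^sub>R w)) \<and>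
     (\<forall>c. maxface P (- w) \<subseteq> maxface P c \<longrightarrow> (\<exists>k. c = k *\<^sub>R w))"

lemma maxface_scale: "k > 0 \<Longrightarrow> maxface P (k *\<^sub>R w) = maxface P w"
  by (auto simp: maxface_def)

lemma prismlike_uminus: 
  assumes "prismlike P w" shows "prismlike P (- w)"
proof -
  have "\<exists>k. c = k *\<^sub>R (- w)" if "\<exists>k. c = k *\<^sub>R w" for c
  proof -
    obtain k where "c = k *\<^sub>R w" using \<open>\<exists>k. c = k *\<^sub>R w\<close> by blast
    then show ?thesis by (intro exI[of _ "- k"]) simp
  qed
  moreover have "- w \<noteq> 0" using assms by (simp add: prismlike_def)
  ultimately show ?thesis using assms unfolding prismlike_def minus_minus by blast
qed

lemma prismlike_scale:
  assumes "prismlike P w" "k > 0" shows "prismlike P (k *\<^sub>R w)"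
proof -
  have "maxface P (- (k *\<^sub>R w)) = maxface P (- w)"
    using maxface_scale[OF assms(2), of P "- w"] by simp
  moreover have "\<exists>j. c = j *\<^sub>R k *\<^sub>R w" if "\<exists>j. c = j *\<^sub>R w" for c
  proof -
    obtain j where "c = j *\<^sub>R w" using \<open>\<exists>j. c = j *\<^sub>R w\<close> by blast
    then show ?thesis using assms(2) by (intro exI[of _ "j / k"]) simp
  qed
  moreover have "k *\<^sub>R w \<noteq> 0" using assms by (simp add: prismlike_def)
  ultimately show ?thesis using assms(1) unfolding prismlike_def maxface_scale[OF assms(2)] by simp
qed

text \<open>A vertex \<open>v'\<close> of \<open>P'\<close> is the only maximizer of some
  \<open>a\<close>. Over \<open>P\<close>, \<open>a\<close> is maximal at some vertex, which is at
  the top or the bottom; so \<open>a\<close> shares a maximizer with \<open>w\<close> or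
  \<open>- w\<close> over \<open>P\<close>, hence over \<open>P'\<close>, where it can only be
  \<open>v'\<close>.\<close>

lemma prismlike_normal_fan:
  assumes fan: "normal_fan P = normal_fan P'" and P: "polytope P" "P \<noteq> {}" and P': "polytope P'" "P' \<noteq> {}"
    and w: "prismlike P w"
  shows "prismlike P' w"
  unfolding prismlike_def
proof (intro conjI allI impI)
  have c: "convex P" "compact P" "convex P'" "compact P'"
    using P P' by (simp_all add: polytope_imp_compact polytope_imp_convex)
  show "w \<noteq> 0" using w by (simp add: prismlike_def)
  show "\<exists>k. c = k *\<^sub>R w" if "maxface P' w \<subseteq> maxface P' c" for c
    using normal_fan_maxface_mono[OF fan c(1,2) P(2) that] w unfolding prismlike_def by blast
  show "\<exists>k. c = k *\<^sub>R w" if "maxface P' (- w) \<subseteq> maxface P' c" for c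
    using normal_fan_maxface_mono[OF fan c(1,2) P(2) that] w unfolding prismlike_def by blast
  fix v' assume v': "v' extreme_point_of P'"
  have "{v'} exposed_face_of P'"
    using exposed_face_of_polyhedron[OF polytope_imp_polyhedron[OF P'(1)]] v' face_of_singleton by blast
  then obtain a b where ab: "P' \<subseteq> {x. a \<bullet> x \<le> b}" "{v'} = P' \<inter> {x. a \<bullet> x = b}"
    unfolding exposed_face_of_def by blast
  have a: "maxface P' a = {v'}"
  proof -
    have "a \<bullet> v' = b" "v' \<in> P'" using ab by auto
    then have "v' \<in> maxface P' a" using ab by (auto simp: maxface_def)
    moreover have "x = v'" if x: "x \<in> maxface P' a" for x
    proof -
      have "a \<bullet> x = b" using maxface_eq[OF x \<open>v' \<in> maxface P' a\<close>] \<open>a \<bullet> v' = b\<close> by simp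
      then have "x \<in> P' \<inter> {x. a \<bullet> x = b}" using maxfaceD(1)[OF x] by simp
      then show ?thesis using ab(2) by blast
    qed
    ultimately show ?thesis by blast
  qed
  obtain v where v: "v extreme_point_of P" "v \<in> maxface P a"
    using face_extreme_point[OF P(1) maxface_face[OF c(1)] maxface_nonempty[OF c(2) P(2)]] by blast
  then have "maxface P a \<inter> maxface P w \<noteq> {} \<or> maxface P a \<inter> maxface P (- w) \<noteq> {}"
    using w unfolding prismlike_def by blast
  then show "v' \<in> maxface P' w \<or> v' \<in> maxface P' (- w)"
    using normal_fan_maxface_Int[OF fan c(1), of a w] normal_fan_maxface_Int[OF fan c(1), of a "- w"]
    unfolding a by auto
qed

lemma convex_level_point:
  fixes F :: "'a::real_inner set"
  assumes "convex F" "a \<in> F" "b \<in> F" "w \<bullet> a \<le> s" "s \<le> w \<bullet> b"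
  obtains x where "x \<in> F" "w \<bullet> x = s"
proof (cases "w \<bullet> a = w \<bullet> b")
  case True then show ?thesis using assms that by fastforce
next
  case False
  define t where "t = (s - w \<bullet> a) / (w \<bullet> b - w \<bullet> a)"
  have t: "0 \<le> t" "t \<le> 1" using False assms by (auto simp: t_def divide_simps)
  have "t * (w \<bullet> b - w \<bullet> a) = s - w \<bullet> a" using False by (simp add: t_def)
  then have "w \<bullet> ((1 - t) *\<^sub>R a + t *\<^sub>R b) = s" by (simp add: inner_add_right algebra_simps)
  moreover have "(1 - t) *\<^sub>R a + t *\<^sub>R b \<in> F" using assms t unfolding convex_alt by blast
  ultimately show ?thesis using that by blast
qed

text \<open>Adding a suitable multiple of \<open>w\<close> balances the maxima of \<open>c\<close> over bottom and top.\<close>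

lemma prismlike_balance:
  assumes P: "polytope P" "P \<noteq> {}" and w: "prismlike P w"
    and ht: "x0 \<in> P" "y0 \<in> P" "w \<bullet> x0 \<noteq> w \<bullet> y0"
  obtains k where "maxface P (c + k *\<^sub>R w) \<inter> maxface P w \<noteq> {}"
    "maxface P (c + k *\<^sub>R w) \<inter> maxface P (- w) \<noteq> {}"
proof -
  have cv: "convex P" "compact P" using P by (simp_all add: polytope_imp_compact polytope_imp_convex)
  define T where "T = maxface P w"
  define B where "B = maxface P (- w)"
  have TB: "T \<noteq> {}" "B \<noteq> {}" "T \<subseteq> P" "B \<subseteq> P" using maxface_nonempty[OF cv(2) P(2)] maxfaceD by (auto simp: T_def B_def)
  have cTB: "compact T" "compact B" using maxface_face[OF cv(1)] face_of_imp_compact cv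
    by (auto simp: T_def B_def)
  obtain p where p: "p \<in> maxface T c" using maxface_nonempty[OF cTB(1) TB(1)] by blast
  obtain q where q: "q \<in> maxface B c" using maxface_nonempty[OF cTB(2) TB(2)] by blast
  have pT: "p \<in> maxface P w" and qB: "q \<in> maxface P (- w)" using p q by (auto simp: maxface_def T_def B_def)
  define h where "h = w \<bullet> p - w \<bullet> q"
  have "h \<noteq> 0"
  proof
    assume "h = 0"
    then have "w \<bullet> x = w \<bullet> p" if "x \<in> P" for x
      using maxfaceD(2)[OF pT that] maxfaceD(2)[OF qB that] by (simp add: h_def)
    then show False using ht by simp
  qed
  define k where "k = - (c \<bullet> p - c \<bullet> q) / h"
  define d where "d = c + k *\<^sub>R w"
  have "k * h = - (c \<bullet> p - c \<bullet> q)" using \<open>h \<noteq> 0\<close> by (simp add: k_def)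
  then have dpq: "d \<bullet> p = d \<bullet> q" by (simp add: d_def h_def inner_add_left algebra_simps)
  \<comment> \<open>Every vertex lies in the top or the bottom, where \<open>w\<close> is constant
    and \<open>d\<close> compares points like \<open>c\<close>.\<close>
  have "d \<bullet> v \<le> d \<bullet> p" if v: "v extreme_point_of P" for v
  proof (cases "v \<in> T")
    case True
    have "w \<bullet> v = w \<bullet> p" using True pT maxface_eq unfolding T_def by blast
    moreover have "c \<bullet> v \<le> c \<bullet> p" using maxfaceD(2)[OF p True] .
    ultimately show ?thesis by (simp add: d_def inner_add_left)
  next
    case False
    then have vB: "v \<in> B" using w v unfolding prismlike_def T_def B_def by blast
    have "w \<bullet> v = w \<bullet> q" using vB qB maxface_eq[of v P "- w" q] unfolding B_def by simp
    moreover have "c \<bullet> v \<le> c \<bullet> q" using maxfaceD(2)[OF q vB] .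
    ultimately show ?thesis unfolding dpq by (simp add: d_def inner_add_left)
  qed
  then have "convex hull {v. v extreme_point_of P} \<subseteq> {x. d \<bullet> x \<le> d \<bullet> p}"
    by (intro hull_minimal convex_halfspace_le) blast
  then have "P \<subseteq> {x. d \<bullet> x \<le> d \<bullet> p}" by (rule ord_eq_le_trans[OF Krein_Milman_Minkowski[OF cv(2,1)]])
  then have "p \<in> maxface P d" "q \<in> maxface P d"
    using dpq maxfaceD(1)[OF pT] maxfaceD(1)[OF qB] by (auto simp: maxface_def)
  then show thesis using that[of k] pT qB unfolding d_def by blast
qed

section \<open>Slices of a Minkowski sum\<close>

lemma minkowski_slice:
  assumes fan: "normal_fan P = normal_fan P'"
    and P: "polytope P" "P \<noteq> {}" and P': "polytope P'" "P' \<noteq> {}"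
    and w: "prismlike P w" and ht: "x0 \<in> P" "y0 \<in> P" "w \<bullet> x0 \<noteq> w \<bullet> y0"
    and xy: "x \<in> P" "y \<in> P'" and st: "w \<bullet> (x + y) = s + t"
    and s: "\<exists>a\<in>P. w \<bullet> a \<le> s" "\<exists>b\<in>P. s \<le> w \<bullet> b" 
    and t: "\<exists>a\<in>P'. w \<bullet> a \<le> t" "\<exists>b\<in>P'. t \<le> w \<bullet> b" 
  obtains x' y' where "x' \<in> P" "y' \<in> P'" "w \<bullet> x' = s" "w \<bullet> y' = t" "x + y = x' + y'"
proof -
  have cv: "convex P" "compact P" "convex P'" "compact P'"
    using P P' by (simp_all add: polytope_imp_compact polytope_imp_convex)
  define A where "A = P \<inter> {x. w \<bullet> x = s}"
  define B where "B = P' \<inter> {x. w \<bullet> x = t}"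
  define S where "S = {x + y | x y. x \<in> A \<and> y \<in> B}"
  have "x + y \<in> S"
  proof (rule ccontr)
    assume n: "x + y \<notin> S"
    have "compact A" "compact B" unfolding A_def B_def
      using cv by (auto intro: compact_Int_closed closed_hyperplane)
    then have "closed S" unfolding S_def by (intro compact_imp_closed compact_sums)
    have "convex A" "convex B" unfolding A_def B_def using cv by (auto intro: convex_Int convex_hyperplane)
    then have "convex (\<Union>x\<in>A. \<Union>y\<in>B. {x + y})" by (rule convex_sums)
    moreover have "(\<Union>x\<in>A. \<Union>y\<in>B. {x + y}) = S" unfolding S_def by blast
    ultimately have "convex S" by simp
    obtain a b where ab: "a \<bullet> (x + y) < b" "\<forall>u\<in>S. b < a \<bullet> u"
      using separating_hyperplane_closed_point[OF \<open>convex S\<close> \<open>closed S\<close> n] by blast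
    obtain k where k: "maxface P (- a + k *\<^sub>R w) \<inter> maxface P w \<noteq> {}"
      "maxface P (- a + k *\<^sub>R w) \<inter> maxface P (- w) \<noteq> {}"
      by (rule prismlike_balance[OF P w ht])
    \<comment> \<open>At a fixed height, maximizing \<open>d\<close> means minimizing
      \<open>a\<close>; the choice of \<open>k\<close> lets the maximizers of \<open>d\<close> reach
      every height.\<close>
    define d where "d = - a + k *\<^sub>R w"
    have level: "\<exists>p\<in>maxface R d. w \<bullet> p = r" 
      if R: "convex R" "maxface R d \<inter> maxface R w \<noteq> {}" "maxface R d \<inter> maxface R (- w) \<noteq> {}"
        and ab: "\<exists>a\<in>R. w \<bullet> a \<le> r" "\<exists>b\<in>R. r \<le> w \<bullet> b" for R r
    proof -
      obtain f g where f: "f \<in> maxface R d" "f \<in> maxface R w" and g: "g \<in> maxface R d" "g \<in> maxface R (- w)"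
        using R by blast
      have "w \<bullet> g \<le> r" "r \<le> w \<bullet> f" using ab maxfaceD(2)[OF f(2)] maxfaceD(2)[OF g(2)] by force+
      then show ?thesis
        using convex_level_point[OF face_of_imp_convex[OF maxface_face[OF R(1)]] g(1) f(1)] by metis
    qed
    obtain p where p: "p \<in> maxface P d" "w \<bullet> p = s" using level[OF cv(1) _ _ s] k unfolding d_def by blast
    have k': "maxface P' d \<inter> maxface P' w \<noteq> {}" "maxface P' d \<inter> maxface P' (- w) \<noteq> {}"
      using normal_fan_maxface_Int[OF fan cv(1)] k unfolding d_def by blast+
    obtain q where q: "q \<in> maxface P' d" "w \<bullet> q = t" using level[OF cv(3) k' t] by blast
    have "p + q \<in> S" using p q maxfaceD(1) unfolding S_def A_def B_def by blast
    then have "b < a \<bullet> (p + q)" using ab by blast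
    moreover have "d \<bullet> (x + y) \<le> d \<bullet> (p + q)"
      using maxfaceD(2)[OF p(1) xy(1)] maxfaceD(2)[OF q(1) xy(2)] by (simp add: inner_add_right)
    moreover have "w \<bullet> (x + y) = w \<bullet> (p + q)" using st p q by (simp add: inner_add_right)
    moreover have "d \<bullet> u = k * (w \<bullet> u) - a \<bullet> u" for u by (simp add: d_def inner_diff_left)
    ultimately show False using ab(1) by simp
  qed
  then show thesis using that unfolding S_def A_def B_def by blast
qed

section \<open>From the face lattice of a prism to parallel supporting planes\<close>

lemma std_prism_eq: "std_prism Q = {q + y | q y. q \<in> Q \<and> y \<in> closed_segment 0 (axis 3 1)}"
proof -
  have eq: "y \<in> closed_segment 0 (axis 3 1 :: real^3) \<longleftrightarrow> (\<exists>t. 0 \<le> t \<and> t \<le> 1 \<and> y = t *\<^sub>R axis 3 1)" for y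
    by (auto simp: in_segment)
  show ?thesis unfolding std_prism_def eq by blast
qed

lemma std_prismI: "q \<in> Q \<Longrightarrow> 0 \<le> t \<Longrightarrow> t \<le> 1 \<Longrightarrow> q + t *\<^sub>R axis 3 1 \<in> std_prism Q"
  unfolding std_prism_def by blast

lemma std_prism_extreme_point:
  assumes "x extreme_point_of std_prism Q"
  shows "x \<in> Q \<or> x \<in> std_top Q"
proof -
  obtain q t where x: "x = q + t *\<^sub>R axis 3 1" "q \<in> Q" "0 \<le> t" "t \<le> 1"
    using assms by (auto simp: extreme_point_of_def std_prism_def)
  have mem: "q \<in> std_prism Q" "q + axis 3 1 \<in> std_prism Q"
    using std_prismI[OF x(2), of 0] std_prismI[OF x(2), of 1] by simp_all
  show ?thesis
  proof (cases "t = 0 \<or> t = 1")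
    case True then show ?thesis using x by (auto simp: std_top_def)
  next
    case False
    have "x = (1 - t) *\<^sub>R q + t *\<^sub>R (q + axis 3 1)" unfolding x(1) by (simp add: algebra_simps)
    moreover have "q \<noteq> q + axis 3 1" by (simp add: axis_eq_0_iff)
    ultimately have "x \<in> open_segment q (q + axis 3 1)"
      using False x(3,4) by (auto simp: in_segment intro!: exI[of _ t])
    then show ?thesis using assms mem unfolding extreme_point_of_def by blast
  qed
qed

lemma std_prism_faces:
  assumes "base_ok Q"
  shows "compact (std_prism Q)" "convex (std_prism Q)" "Q face_of std_prism Q"
    "std_top Q face_of std_prism Q" "Q \<inter> std_top Q = {}"
proof -
  have Q: "compact Q" "convex Q" and Q0: "\<And>q. q \<in> Q \<Longrightarrow> q $ 3 = 0"
    using assms by (auto simp: base_ok_def polytope_imp_compact polytope_imp_convex)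
  show "compact (std_prism Q)" unfolding std_prism_eq using Q by (intro compact_sums) auto
  have "convex (\<Union>x\<in>Q. \<Union>y\<in>closed_segment 0 (axis 3 1). {x + y})" using Q by (intro convex_sums) auto
  moreover have "(\<Union>x\<in>Q. \<Union>y\<in>closed_segment 0 (axis 3 1). {x + y}) = std_prism Q"
    unfolding std_prism_eq by blast
  ultimately show cv: "convex (std_prism Q)" by simp
  have h: "axis 3 1 \<bullet> x = x $ 3" for x :: "real^3" by (simp add: inner_axis')
  have ht: "(q + t *\<^sub>R axis 3 1) $ 3 = t" if "q \<in> Q" for q t using Q0[OF that] by simp
  have Q_eq: "Q = std_prism Q \<inter> {x. axis 3 1 \<bullet> x = 0}"
  proof (intro equalityI subsetI)
    fix x assume "x \<in> Q"
    then show "x \<in> std_prism Q \<inter> {x. axis 3 1 \<bullet> x = 0}" using std_prismI[of x Q 0] Q0 by (simp add: h)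
  next
    fix x assume x: "x \<in> std_prism Q \<inter> {x. axis 3 1 \<bullet> x = 0}"
    then obtain q t where q: "x = q + t *\<^sub>R axis 3 1" "q \<in> Q" by (auto simp: std_prism_def)
    then have "t = 0" using ht[OF q(2), of t] x by (simp add: h)
    then show "x \<in> Q" using q by simp
  qed
  have "(std_prism Q \<inter> {x. axis 3 1 \<bullet> x = 0}) face_of std_prism Q"
    by (rule face_of_Int_supporting_hyperplane_ge[OF cv]) (auto simp: h std_prism_def ht Q0)
  then show "Q face_of std_prism Q" unfolding Q_eq[symmetric] .
  have top_eq: "std_top Q = std_prism Q \<inter> {x. axis 3 1 \<bullet> x = 1}"
  proof (intro equalityI subsetI)
    fix x assume "x \<in> std_top Q"
    then obtain q where q: "q \<in> Q" "x = q + 1 *\<^sub>R axis 3 1" by (auto simp: std_top_def)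
    then show "x \<in> std_prism Q \<inter> {x. axis 3 1 \<bullet> x = 1}"
      using std_prismI[OF q(1), of 1] ht[OF q(1), of 1] by (simp add: h)
  next
    fix x assume x: "x \<in> std_prism Q \<inter> {x. axis 3 1 \<bullet> x = 1}"
    then obtain q t where q: "x = q + t *\<^sub>R axis 3 1" "q \<in> Q" by (auto simp: std_prism_def)
    then have "t = 1" using ht[OF q(2), of t] x by (simp add: h)
    then show "x \<in> std_top Q" using q by (simp add: std_top_def)
  qed
  have "(std_prism Q \<inter> {x. axis 3 1 \<bullet> x = 1}) face_of std_prism Q"
    by (rule face_of_Int_supporting_hyperplane_le[OF cv]) (auto simp: h std_prism_def ht Q0)
  then show "std_top Q face_of std_prism Q" unfolding top_eq .
  have "x $ 3 = 1" if "x \<in> std_top Q" for x using that ht[of _ 1] by (auto simp: std_top_def)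
  then show "Q \<inter> std_top Q = {}" using Q0 by (metis disjoint_iff zero_neq_one)
qed

lemma lin_space_const:
  assumes "F \<subseteq> maxface P c" "y \<in> lin_space F"
  shows "c \<bullet> y = 0"
proof -
  have "{x - y |x y. x \<in> F \<and> y \<in> F} \<subseteq> {y. c \<bullet> y = 0}"
  proof safe
    fix x y assume "x \<in> F" "y \<in> F"
    then show "c \<bullet> (x - y) = 0" using maxface_eq[of x P c y] assms(1) by (auto simp: inner_diff_right)
  qed
  then have "lin_space F \<subseteq> {y. c \<bullet> y = 0}"
    unfolding lin_space_def by (intro span_minimal subspace_hyperplane)
  then show ?thesis using assms(2) by blast
qed

lemma lin_space_plane:
  assumes w: "w \<noteq> 0" "\<And>y. y \<in> lin_space F \<Longrightarrow> w \<bullet> y = 0" and dim: "aff_dim F = 2"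
  shows "lin_space F = {y. w \<bullet> y = 0}"
proof -
  have "F \<noteq> {}" using dim by auto
  then obtain a where a: "a \<in> F" by blast
  have "dim ((+) (- a) ` F) = 2" using aff_dim_eq_dim[OF hull_inc[OF a]] dim by simp
  moreover have "(+) (- a) ` F \<subseteq> lin_space F"
    unfolding lin_space_def using a by (force intro: span_base)
  ultimately have "2 \<le> dim (lin_space F)" using dim_subset by metis
  moreover have "dim {y. w \<bullet> y = 0} = 2" using dim_hyperplane[OF w(1)] by simp
  moreover have "lin_space F \<subseteq> {y. w \<bullet> y = 0}" using w(2) by blast
  ultimately have "span (lin_space F) = span {y. w \<bullet> y = 0}" by (intro dim_eq_span) auto
  moreover have "span (lin_space F) = lin_space F" by (simp add: lin_space_def)
  moreover have "span {y. w \<bullet> y = 0} = {y. w \<bullet> y = 0}" by (simp only: span_eq_iff subspace_hyperplane)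
  ultimately show ?thesis by simp
qed

lemma plane_normal_unique:
  fixes w c :: "'a::real_inner"
  assumes "w \<noteq> 0" "\<And>y. w \<bullet> y = 0 \<Longrightarrow> c \<bullet> y = 0"
  shows "\<exists>k. c = k *\<^sub>R w"
proof -
  define k where "k = (c \<bullet> w) / (w \<bullet> w)"
  define r where "r = c - k *\<^sub>R w"
  have "w \<bullet> r = 0" using assms(1) by (simp add: r_def k_def inner_diff_right inner_commute)
  then have "c \<bullet> r = 0" by (rule assms(2))
  moreover have "r \<bullet> r = c \<bullet> r - k * (w \<bullet> r)" unfolding r_def by (simp add: inner_diff_left)
  ultimately have "r \<bullet> r = 0" using \<open>w \<bullet> r = 0\<close> by simp
  then have "c = k *\<^sub>R w" by (simp add: r_def)
  then show ?thesis ..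
qed

text \<open>The isomorphism preserves inclusions only, so dimensions must be recovered: a facet
  containing \<open>B\<close> corresponds to a proper face of the prism containing the
  two-dimensional base, and dimension 3 leaves room for the base alone.\<close>

lemma prismatoid_facets:
  assumes P: "polytope P" "aff_dim P = 3" and pr: "prismatoid3 P"
  obtains B T where "B facet_of P" "T face_of P" "T \<noteq> {}" "B \<inter> T = {}" "lin_space B = lin_space T"
    "\<forall>v. v extreme_point_of P \<longrightarrow> v \<in> B \<union> T"
proof -
  obtain Q g b \<phi> where Q: "base_ok Q" and g: "linear g" "bij g"
    and iso: "face_lattice_iso \<phi> ((\<lambda>x. g x + b) ` std_prism Q) P"
    and lin: "lin_space (\<phi> ((\<lambda>x. g x + b) ` std_top Q)) = lin_space (\<phi> ((\<lambda>x. g x + b) ` Q))"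
    using pr unfolding prismatoid3_def Let_def by blast
  define f where "f x = g x + b" for x
  define A where "A = f ` std_prism Q"
  note sp = std_prism_faces[OF Q]
  have inj: "inj g" using g by (simp add: bij_is_inj)
  have fimg: "f ` S = (+) b ` (g ` S)" for S by (auto simp: f_def image_image add.commute)
  have fface: "f ` S face_of f ` T \<longleftrightarrow> S face_of T" for S T
    unfolding fimg by (simp add: face_of_linear_image[OF g(1) inj])
  have fdim: "aff_dim (f ` S) = aff_dim S" for S
    unfolding fimg by (simp add: aff_dim_translation_eq aff_dim_injective_linear_image[OF g(1) inj])
  have injf: "inj f" using inj by (auto simp: inj_def f_def)
  have cA: "compact A" "convex A" unfolding A_def fimg using sp(1,2) g(1)
    by (auto intro!: compact_translation compact_continuous_image linear_continuous_on
        convex_translation convex_linear_image simp: linear_conv_bounded_linear)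
  have bij: "bij_betw \<phi> {F. F face_of A} {G. G face_of P}"
    and mono: "\<And>F G. F face_of A \<Longrightarrow> G face_of A \<Longrightarrow> F \<subseteq> G \<longleftrightarrow> \<phi> F \<subseteq> \<phi> G"
    using iso unfolding face_lattice_iso_def A_def f_def by auto
  have \<phi>face: "\<phi> F face_of P" if "F face_of A" for F using bij that by (auto simp: bij_betw_def)
  have surj: "\<exists>F. F face_of A \<and> \<phi> F = G" if "G face_of P" for G
    using bij that unfolding bij_betw_def by (metis (no_types, lifting) imageE mem_Collect_eq)
  have \<phi>empty: "\<phi> {} = {}"
  proof -
    obtain X where "X face_of A" "\<phi> X = {}" using surj[of "{}"] by auto
    then show ?thesis using mono[of "{}" X] by simp
  qed
  have \<phi>nonempty: "\<phi> F \<noteq> {}" if "F face_of A" "F \<noteq> {}" for F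
    using mono[OF that(1), of "{}"] that \<phi>empty by auto
  have \<phi>top: "\<phi> A = P"
  proof -
    obtain X where "X face_of A" "\<phi> X = P"
      using surj[of P] P by (auto simp: face_of_refl polytope_imp_convex)
    moreover have "A face_of A" using cA by (simp add: face_of_refl)
    ultimately have "P \<subseteq> \<phi> A" using mono[of X A] face_of_imp_subset by blast
    then show ?thesis using face_of_imp_subset[OF \<phi>face[OF \<open>A face_of A\<close>]] by blast
  qed
  define Bo where "Bo = f ` Q"
  define To where "To = f ` std_top Q"
  have fc: "Bo face_of A" "To face_of A" using sp by (simp_all add: Bo_def To_def A_def fface)
  have Qne: "Q \<noteq> {}" using Q by (auto simp: base_ok_def)
  have ne: "Bo \<noteq> {}" "To \<noteq> {}" using Qne by (auto simp: Bo_def To_def std_top_def)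
  have dj: "Bo \<inter> To = {}" unfolding Bo_def To_def using sp(5) injf by (simp flip: image_Int)
  define B where "B = \<phi> Bo"
  define T where "T = \<phi> To"
  have BT: "B face_of P" "T face_of P" "B \<noteq> {}" "T \<noteq> {}"
    using fc ne \<phi>face \<phi>nonempty by (auto simp: B_def T_def)
  have disj: "B \<inter> T = {}"
  proof -
    obtain X where X: "X face_of A" "\<phi> X = B \<inter> T" using surj face_of_Int[OF BT(1,2)] by blast
    then have "X \<subseteq> Bo" "X \<subseteq> To" using mono fc unfolding B_def T_def by blast+
    then have "X = {}" using dj by blast
    then show ?thesis using X \<phi>empty by simp
  qed
  \<comment> \<open>The face \<open>X\<close> corresponding to \<open>v\<close> contains an extreme
    point \<open>x\<close> of the prism, and \<open>{x}\<close> is already mapped to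
    \<open>{v}\<close>; extreme points of a prism lie in its base or its top.\<close>
  have ext: "v \<in> B \<union> T" if v: "v extreme_point_of P" for v
  proof -
    obtain X where X: "X face_of A" "\<phi> X = {v}" using surj v face_of_singleton by blast
    have "X \<noteq> {}" using X \<phi>empty by auto
    have "compact X" "convex X" using X cA face_of_imp_compact face_of_imp_convex by blast+
    then obtain x where "x extreme_point_of X" using extreme_point_exists_convex \<open>X \<noteq> {}\<close> by blast
    then have x: "{x} face_of A" "x \<in> X" using X extreme_point_of_face face_of_singleton by blast+
    then have "\<phi> {x} \<subseteq> {v}" using mono[OF x(1) X(1)] X by auto
    then have \<phi>x: "\<phi> {x} = {v}" using \<phi>nonempty[OF x(1)] by blast
    obtain y where y: "y \<in> std_prism Q" "x = f y" using face_of_imp_subset[OF x(1)] by (auto simp: A_def)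
    have "{y} face_of std_prism Q" using x(1) fface[of "{y}" "std_prism Q"] y by (simp add: A_def)
    then have "y \<in> Q \<or> y \<in> std_top Q" using std_prism_extreme_point face_of_singleton by blast
    then have "{x} \<subseteq> Bo \<or> {x} \<subseteq> To" using y by (auto simp: Bo_def To_def)
    then have "{v} \<subseteq> B \<or> {v} \<subseteq> T"
      using mono[OF x(1) fc(1)] mono[OF x(1) fc(2)] unfolding \<phi>x B_def T_def by blast
    then show ?thesis by blast
  qed
  have "B \<noteq> P" using disj BT face_of_imp_subset by blast
  then obtain F where F: "F facet_of P" "B \<subseteq> F"
    using face_of_polyhedron_subset_facet[OF polytope_imp_polyhedron[OF P(1)] BT(1,3)] by blast
  obtain X where X: "X face_of A" "\<phi> X = F" using surj facet_of_imp_face_of[OF F(1)] by blast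
  have "Bo \<subseteq> X" using mono[OF fc(1) X(1)] F X by (simp add: B_def)
  have "X \<noteq> A" using X F(1) \<phi>top by auto
  have "X = Bo"
  proof (rule ccontr)
    assume "X \<noteq> Bo"
    have "Bo face_of X" using face_of_subset[OF fc(1) \<open>Bo \<subseteq> X\<close> face_of_imp_subset[OF X(1)]] .
    then have "aff_dim Bo < aff_dim X"
      using face_of_aff_dim_lt[OF face_of_imp_convex[OF X(1)]] \<open>X \<noteq> Bo\<close> by blast
    moreover have "aff_dim X < aff_dim A" using face_of_aff_dim_lt[OF cA(2) X(1)] \<open>X \<noteq> A\<close> by blast
    moreover have "aff_dim Bo = 2" using Q by (simp add: Bo_def fdim base_ok_def)
    moreover have "aff_dim A \<le> 3" using aff_dim_le_DIM[of A] by simp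
    ultimately show False by linarith
  qed
  then have "B facet_of P" using X F by (simp add: B_def)
  then show thesis using that[of B T] BT disj ext lin
    unfolding B_def T_def Bo_def To_def f_def[abs_def] by blast
qed

text \<open>\<open>- w\<close> is taken to support \<open>P\<close> along the facet
  \<open>B\<close>. As \<open>lin_space T\<close> is the plane orthogonal to \<open>w\<close>,
  \<open>w\<close> is constant on \<open>T\<close> too, and since all vertices are in
  \<open>B\<close> or \<open>T\<close>, it is maximal there. A functional maximal on all of
  \<open>B\<close> or all of \<open>T\<close> vanishes on that plane, hence is a multiple of
  \<open>w\<close>.\<close>

lemma prismatoid_prismlike:
  assumes P: "polytope P" "aff_dim P = 3" and pr: "prismatoid3 P"
  obtains w where "prismlike P w"
proof -
  obtain B T where B: "B facet_of P" and T: "T face_of P" "T \<noteq> {}" and disj: "B \<inter> T = {}"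
    and lin: "lin_space B = lin_space T" and ext: "\<forall>v. v extreme_point_of P \<longrightarrow> v \<in> B \<union> T"
    by (rule prismatoid_facets[OF P pr])
  have BP: "B face_of P" "B \<noteq> {}" "aff_dim B = 2" using B P by (auto simp: facet_of_def)
  have subs: "B \<subseteq> P" "T \<subseteq> P" using BP(1) T(1) face_of_imp_subset by blast+
  have "B exposed_face_of P"
    using exposed_face_of_polyhedron[OF polytope_imp_polyhedron[OF P(1)]] BP by blast
  then obtain a b where ab: "P \<subseteq> {x. a \<bullet> x \<le> b}" "B = P \<inter> {x. a \<bullet> x = b}"
    unfolding exposed_face_of_def by blast
  obtain x0 where x0: "x0 \<in> B" using BP by blast
  obtain y0 where y0: "y0 \<in> T" using T by blast
  define w where "w = - a"
  have Bmax: "B \<subseteq> maxface P (- w)" using ab by (auto simp: maxface_def w_def)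
  have "a \<bullet> y0 \<noteq> b" using disj y0 ab subs by blast
  then have y0b: "a \<bullet> y0 < b" using ab(1) y0 subs by (auto simp: order.order_iff_strict)
  have x0b: "a \<bullet> x0 = b" using x0 ab by blast
  have "w \<noteq> 0" using y0b x0b by (auto simp: w_def)
  have wlin: "w \<bullet> y = 0" if "y \<in> lin_space B" for y
    using lin_space_const[OF Bmax that] by simp
  have plane: "lin_space B = {y. w \<bullet> y = 0}" by (rule lin_space_plane[OF \<open>w \<noteq> 0\<close> wlin BP(3)])
  have Tw: "w \<bullet> y = w \<bullet> y0" if "y \<in> T" for y
  proof -
    have "y - y0 \<in> lin_space T" unfolding lin_space_def using that y0 by (intro span_base) blast
    then show ?thesis using plane lin by (auto simp: inner_diff_right)
  qed
  have Bw: "w \<bullet> x = w \<bullet> x0" if "x \<in> B" for x using that x0 ab by (simp add: w_def)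
  have "{v. v extreme_point_of P} \<subseteq> {x. w \<bullet> x \<le> w \<bullet> y0}"
    using ext Tw Bw y0b x0b by (force simp: w_def)
  then have "convex hull {v. v extreme_point_of P} \<subseteq> {x. w \<bullet> x \<le> w \<bullet> y0}"
    by (rule hull_minimal) (rule convex_halfspace_le)
  then have le: "P \<subseteq> {x. w \<bullet> x \<le> w \<bullet> y0}"
    by (rule ord_eq_le_trans[OF Krein_Milman_Minkowski[OF polytope_imp_compact[OF P(1)] polytope_imp_convex[OF P(1)]]])
  have Tmax: "T \<subseteq> maxface P w"
  proof
    fix y assume "y \<in> T"
    then show "y \<in> maxface P w" using Tw[of y] le subs by (auto simp: maxface_def)
  qed
  have ray: "\<exists>k. c = k *\<^sub>R w" if "B \<subseteq> maxface P c \<or> T \<subseteq> maxface P c" for c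
  proof (rule plane_normal_unique[OF \<open>w \<noteq> 0\<close>])
    fix y assume "w \<bullet> y = 0"
    then have "y \<in> lin_space B" "y \<in> lin_space T" using plane lin by auto
    then show "c \<bullet> y = 0" using that lin_space_const by blast
  qed
  have "prismlike P w" unfolding prismlike_def
  proof (intro conjI allI impI)
    show "w \<noteq> 0" by fact
    show "v \<in> maxface P w \<or> v \<in> maxface P (- w)" if "v extreme_point_of P" for v
      using ext that Bmax Tmax by blast
    show "\<exists>k. c = k *\<^sub>R w" if "maxface P w \<subseteq> maxface P c" for c
      using ray[of c] Tmax that by blast
    show "\<exists>k. c = k *\<^sub>R w" if "maxface P (- w) \<subseteq> maxface P c" for c
      using ray[of c] Bmax that by blast
  qed
  then show thesis by (rule that)
qed

section \<open>Lattice points in slices\<close>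

lemma dual_basis_inner:
  assumes "dual_basis U n"
  shows "d \<bullet> x = (\<Sum>u\<in>U. (n u \<bullet> x) * (d \<bullet> u))"
proof -
  have "d \<bullet> x = d \<bullet> (\<Sum>u\<in>U. (n u \<bullet> x) *\<^sub>R u)" using dual_basisD(5)[OF assms, of x] by simp
  then show ?thesis by (simp add: inner_sum_right)
qed

text \<open>Complementary slackness: in frame coordinates \<open>d \<bullet> (x - v)\<close> is a
  sum of nonpositive terms, all zero when \<open>d\<close> is maximal at \<open>x\<close>. So where
  \<open>d \<bullet> u\<close> is negative, the coordinate at \<open>u\<close> has its minimal value
  0.\<close>

lemma frame_face_normal:
  assumes U: "dual_basis U n" and pos: "\<forall>u\<in>U. \<forall>x\<in>P. 0 \<le> n u \<bullet> (x - v)"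
    and v: "v \<in> maxface P d" and le: "\<And>u. u \<in> U \<Longrightarrow> d \<bullet> u \<le> 0" and u: "u \<in> U" "d \<bullet> u < 0"
  shows "maxface P d \<subseteq> maxface P (- n u)"
proof
  fix x assume x: "x \<in> maxface P d"
  have xP: "x \<in> P" using maxfaceD(1)[OF x] .
  have "(\<Sum>u\<in>U. (n u \<bullet> (x - v)) * (- (d \<bullet> u))) = - (d \<bullet> (x - v))"
    unfolding dual_basis_inner[OF U, of d "x - v"] by (simp add: sum_negf)
  also have "\<dots> = 0" using maxface_eq[OF x v] by (simp add: inner_diff_right)
  finally have "(\<Sum>u\<in>U. (n u \<bullet> (x - v)) * (- (d \<bullet> u))) = 0" .
  moreover have "\<forall>u\<in>U. 0 \<le> (n u \<bullet> (x - v)) * (- (d \<bullet> u))"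
    using pos xP le by (intro ballI mult_nonneg_nonneg) auto
  ultimately have "(n u \<bullet> (x - v)) * (- (d \<bullet> u)) = 0"
    using sum_nonneg_eq_0_iff[OF dual_basisD(1)[OF U], of "\<lambda>u. (n u \<bullet> (x - v)) * (- (d \<bullet> u))"] u(1) by simp
  then have "n u \<bullet> x = n u \<bullet> v" using u(2) by (simp add: inner_diff_right)
  moreover have "n u \<bullet> v \<le> n u \<bullet> y" if "y \<in> P" for y
    using pos u(1) that by (force simp: inner_diff_right)
  ultimately show "x \<in> maxface P (- n u)" using xP by (simp add: maxface_def)
qed

text \<open>If two frame vectors rose, \<open>frame_face_normal\<close> and the ray condition would
  make \<open>- n u\<close> a multiple of \<open>w\<close> for one of them; but \<open>n u\<close>
  vanishes on the other, where \<open>w\<close> does not. If none rose, \<open>w\<close> would be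
  0.\<close>

lemma bottom_vertex:
  assumes w: "prismlike P w" and v: "v \<in> maxface P (- w)"
    and U: "dual_basis U n" and mem: "\<forall>u\<in>U. v + u \<in> P" and pos: "\<forall>u\<in>U. \<forall>x\<in>P. 0 \<le> n u \<bullet> (x - v)"
  obtains u where "u \<in> U" "w \<bullet> u > 0" "\<forall>u'\<in>U - {u}. w \<bullet> u' = 0"
proof -
  have nonneg: "w \<bullet> u \<ge> 0" if "u \<in> U" for u
    using maxfaceD(2)[OF v, of "v + u"] mem that by (simp add: inner_add_right)
  have uniq: "u = u'" if u: "u \<in> U" "w \<bullet> u > 0" and u': "u' \<in> U" "w \<bullet> u' > 0" for u u'
  proof (rule ccontr)
    assume "u \<noteq> u'"
    have "maxface P (- w) \<subseteq> maxface P (- n u)"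
      by (rule frame_face_normal[OF U pos v]) (use nonneg u in auto)
    then obtain k where k: "- n u = k *\<^sub>R w" using w unfolding prismlike_def by blast
    have "(- n u) \<bullet> u' = 0" using dual_basisD(4)[OF U u(1) u'(1)] \<open>u \<noteq> u'\<close> by simp
    then have "k = 0" unfolding k using u' by simp
    then have "n u = 0" using k by simp
    then show False using dual_basisD(4)[OF U u(1) u(1)] by simp
  qed
  have "\<exists>u\<in>U. w \<bullet> u > 0"
  proof (rule ccontr)
    assume "\<not> ?thesis"
    then have "\<forall>u\<in>U. w \<bullet> u = 0" using nonneg by force
    then have "w \<bullet> w = 0" using dual_basis_inner[OF U, of w w] by simp
    then show False using w by (simp add: prismlike_def)
  qed
  then obtain u where u: "u \<in> U" "w \<bullet> u > 0" by blast
  moreover have "w \<bullet> u' = 0" if "u' \<in> U - {u}" for u'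
    using uniq[OF u, of u'] nonneg[of u'] that by force
  ultimately show thesis using that by blast
qed

text \<open>Primitivity of \<open>w\<close> in the dual lattice: heights number the lattice planes
  consecutively.\<close>

definition unit_normal :: "real^3 \<Rightarrow> bool" where
  "unit_normal w \<longleftrightarrow> (\<forall>x. lattice_pt x \<longrightarrow> w \<bullet> x \<in> \<int>) \<and> (\<exists>x. lattice_pt x \<and> w \<bullet> x = 1)"

lemma sum_single:
  assumes "finite U" "u \<in> U" "\<forall>u'\<in>U - {u}. f u' = (0::real)"
  shows "sum f U = f u"
  using assms by (simp add: sum.remove)

text \<open>Only \<open>u\<close> contributes to heights, so the height of every lattice vector is a
  multiple of the integer \<open>w \<bullet> u\<close>, and the height 1 occurs.\<close>

lemma bottom_unit:
  assumes w: "unit_normal w" and U: "dual_basis U n"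
    and u: "u \<in> U" "w \<bullet> u > 0" "\<forall>u'\<in>U - {u}. w \<bullet> u' = 0"
  shows "w \<bullet> u = 1"
proof -
  obtain x where x: "lattice_pt x" "w \<bullet> x = 1" using w unfolding unit_normal_def by blast
  have "w \<bullet> x = (n u \<bullet> x) * (w \<bullet> u)"
    unfolding dual_basis_inner[OF U, of w x]
    by (rule sum_single[OF dual_basisD(1)[OF U] u(1)]) (use u(3) in simp)
  then have e: "(n u \<bullet> x) * (w \<bullet> u) = 1" using x by simp
  obtain i where i: "n u \<bullet> x = of_int i" using dual_basisD(6)[OF U x(1) u(1)] by (rule Ints_cases)
  obtain j where j: "w \<bullet> u = of_int j" 
    using w dual_basisD(3)[OF U u(1)] unfolding unit_normal_def by (metis Ints_cases)
  have "i * j = 1" using e unfolding i j by (metis of_int_eq_1_iff of_int_mult)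
  moreover have "j > 0" using u(2) j by simp
  ultimately have "j = 1" by (metis zmult_eq_1_iff less_irrefl zero_less_one neg_0_less_iff_less order_less_trans)
  then show ?thesis using j by simp
qed

text \<open>Such a point is a vertex of \<open>P\<close> or lies on an edge rising from a bottom
  vertex. The primitive vector of that edge has height 1, so an integral height difference is an
  integral number of steps.\<close>

lemma slice_extreme_lattice:
  assumes P: "smooth_polytope3 P" and w: "prismlike P w" "unit_normal w" and s: "s \<in> \<int>"
    and x: "x extreme_point_of (P \<inter> {y. w \<bullet> y = s})"
  shows "lattice_pt x"
proof (cases "x extreme_point_of P")
  case True then show ?thesis using smooth_polytope3D(3)[OF P] by blast
next
  case False
  obtain a b where ab: "closed_segment a b edge_of P" "a extreme_point_of P" "b extreme_point_of P"
    "x \<in> closed_segment a b" "w \<bullet> a < s" "s < w \<bullet> b"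
    by (rule slice_extreme[OF smooth_polytope3D(1)[OF P] x False])
  have "b \<in> P" using ab(3) by (simp add: extreme_point_of_def)
  then have "a \<notin> maxface P w" using ab(5,6) maxfaceD(2)[of a P w b] by auto
  then have a: "a \<in> maxface P (- w)" using w(1) ab(2) unfolding prismlike_def by blast
  obtain U n where U: "dual_basis U n" "\<forall>u\<in>U. a + u \<in> P" "\<forall>u\<in>U. \<forall>x\<in>P. 0 \<le> n u \<bullet> (x - a)"
    "\<forall>b. closed_segment a b edge_of P \<longrightarrow> (\<exists>u\<in>U. \<exists>k>0. b = a + k *\<^sub>R u)"
    by (rule smooth_vertex[OF P ab(2)])
  obtain u3 where u3: "u3 \<in> U" "w \<bullet> u3 > 0" "\<forall>u'\<in>U - {u3}. w \<bullet> u' = 0"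
    by (rule bottom_vertex[OF w(1) a U(1-3)])
  obtain u k where u: "u \<in> U" "k > 0" "b = a + k *\<^sub>R u" using U(4) ab(1) by blast
  have "k * (w \<bullet> u) > 0" using ab(5,6) unfolding u(3) by (simp add: inner_add_right)
  then have "u = u3" using u3 u(1) by force
  then have wu: "w \<bullet> u = 1" using bottom_unit[OF w(2) U(1) u3] by simp
  obtain t where t: "x = (1 - t) *\<^sub>R a + t *\<^sub>R b" using ab(4) by (auto simp: in_segment)
  have xa: "x = a + (t * k) *\<^sub>R u" unfolding t u(3) by (simp add: algebra_simps)
  have la: "lattice_pt a" using smooth_polytope3D(3)[OF P ab(2)] .
  have "w \<bullet> x = s" using x by (simp add: extreme_point_of_def)
  then have "t * k = s - w \<bullet> a" unfolding xa by (simp add: inner_add_right wu)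
  then have "t * k \<in> \<int>" using s la w(2) by (simp add: unit_normal_def)
  then show ?thesis unfolding xa by (intro lattice_pt_add lattice_pt_scale la dual_basisD(3)[OF U(1) u(1)])
qed

lemma slice_lattice_hull:
  assumes P: "smooth_polytope3 P" and w: "prismlike P w" "unit_normal w" and s: "s \<in> \<int>"
    and S: "S = P \<inter> {y. w \<bullet> y = s}"
  shows "S = convex hull {x \<in> S. lattice_pt x}" "finite {x \<in> S. lattice_pt x}"
proof -
  have "polytope S" unfolding S using smooth_polytope3D(1)[OF P]
    by (simp add: polytope_Int_polyhedron polyhedron_hyperplane)
  then have c: "compact S" "convex S" by (auto simp: polytope_imp_compact polytope_imp_convex)
  have "{x. x extreme_point_of S} \<subseteq> {x \<in> S. lattice_pt x}"
    using slice_extreme_lattice[OF P w s] unfolding S by (auto simp: extreme_point_of_def)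
  then have "S \<subseteq> convex hull {x \<in> S. lattice_pt x}"
    by (intro ord_eq_le_trans[OF Krein_Milman_Minkowski[OF c]] hull_mono)
  moreover have "convex hull {x \<in> S. lattice_pt x} \<subseteq> S" using c(2) by (intro hull_minimal) auto
  ultimately show "S = convex hull {x \<in> S. lattice_pt x}" by blast
  show "finite {x \<in> S. lattice_pt x}" using c(1) by (intro finite_lattice_pts compact_imp_bounded)
qed

text \<open>An edge of a slice of \<open>P'\<close> comes from a side facet. The face of \<open>P\<close> with the same normals
  contains a bottom edge, because otherwise its normal cone would contain two independent vectors
  orthogonal to both the edge of the slice and the upward edge at a bottom vertex.\<close>

lemma slice_edge:
  assumes fan: "normal_fan P = normal_fan P'" and P: "smooth_polytope3 P"
    and P': "polytope P'" "P' \<noteq> {}" and w: "prismlike P w"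
    and d: "maxface P d \<inter> maxface P w \<noteq> {}" "maxface P d \<inter> maxface P (- w) \<noteq> {}"
    and q: "q \<in> maxface P' d" "q' \<in> maxface P' d" "q \<noteq> q'" "w \<bullet> q = w \<bullet> q'"
    and s: "\<exists>a\<in>P. w \<bullet> a \<le> s" "\<exists>b\<in>P. s < w \<bullet> b"
  obtains y y' where "y \<in> maxface P d" "y' \<in> maxface P d" "y \<noteq> y'" "w \<bullet> y = s" "w \<bullet> y' = s"
proof -
  note PD = smooth_polytope3D[OF P]
  have cP: "convex P" using PD(1) by (simp add: polytope_imp_convex)
  have cP': "convex P'" "compact P'" using P' by (simp_all add: polytope_imp_compact polytope_imp_convex)
  have "(maxface P d \<inter> maxface P (- w)) face_of P" using cP by (intro face_of_Int maxface_face)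
  then obtain v where v: "v extreme_point_of P" "v \<in> maxface P d" "v \<in> maxface P (- w)"
    using face_extreme_point[OF PD(1) _ d(2)] by blast
  obtain U n where U: "dual_basis U n" "\<forall>u\<in>U. v + u \<in> P" "\<forall>u\<in>U. \<forall>x\<in>P. 0 \<le> n u \<bullet> (x - v)"
    by (rule smooth_vertex[OF P v(1)])
  obtain u3 where u3: "u3 \<in> U" "w \<bullet> u3 > 0" "\<forall>u'\<in>U - {u3}. w \<bullet> u' = 0"
    by (rule bottom_vertex[OF w v(3) U])
  have le: "d \<bullet> u \<le> 0" if "u \<in> U" for u
    using maxfaceD(2)[OF v(2), of "v + u"] U(2) that by (simp add: inner_add_right)
  have "\<exists>u\<in>U - {u3}. d \<bullet> u = 0"
  proof (rule ccontr)
    assume "\<not> ?thesis"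
    then have lt: "d \<bullet> u < 0" if "u \<in> U - {u3}" for u using le[of u] that by force
    \<comment> \<open>\<open>d\<close> decreases along both other frame vectors, so its face in
      \<open>P\<close> lies where both \<open>n u\<close> are minimal. This passes to
      \<open>P'\<close>, leaving for \<open>q' - q\<close> only the direction of \<open>u3\<close>,
      which changes the height.\<close>
    have orth: "n u \<bullet> (q' - q) = 0" if u: "u \<in> U - {u3}" for u
    proof -
      have "maxface P d \<subseteq> maxface P (- n u)"
        using u lt[OF u] by (intro frame_face_normal[OF U(1,3) v(2) le]) auto
      then have "maxface P' d \<subseteq> maxface P' (- n u)"
        using normal_fan_maxface_mono[OF fan[symmetric] cP' P'(2)] by blast
      then have "(- n u) \<bullet> q = (- n u) \<bullet> q'" using q(1,2) maxface_eq by blast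
      then show ?thesis by (simp add: inner_diff_right)
    qed
    have "q' - q = (\<Sum>u\<in>U. (n u \<bullet> (q' - q)) *\<^sub>R u)" by (rule dual_basisD(5)[OF U(1)])
    also have "\<dots> = (n u3 \<bullet> (q' - q)) *\<^sub>R u3"
      using orth dual_basisD(1)[OF U(1)] u3(1) by (simp add: sum.remove[of U u3])
    finally have e: "q' - q = (n u3 \<bullet> (q' - q)) *\<^sub>R u3" .
    have "w \<bullet> (q' - q) = 0" using q(4) by (simp add: inner_diff_right)
    then have "(n u3 \<bullet> (q' - q)) * (w \<bullet> u3) = 0" by (subst (asm) e) simp
    then have "n u3 \<bullet> (q' - q) = 0" using u3(2) by simp
    then have "q' - q = 0" using e by simp
    then show False using q(3) by simp
  qed
  then obtain u where u: "u \<in> U - {u3}" "d \<bullet> u = 0" by blast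
  \<comment> \<open>\<open>v\<close> and \<open>v'\<close> span the bottom edge. Moving both towards
    one top point up to height \<open>s\<close> keeps them distinct, because \<open>s\<close> is
    strictly below the top.\<close>
  define v' where "v' = v + u"
  have "w \<bullet> u = 0" using u3 u by blast
  have "u \<noteq> 0" using dual_basisD(4)[OF U(1), of u u] u by auto
  have v': "v' \<in> maxface P d" "w \<bullet> v' = w \<bullet> v" "v' \<noteq> v"
    using maxface_eqI[OF v(2), of v'] U(2) u \<open>w \<bullet> u = 0\<close> \<open>u \<noteq> 0\<close> by (auto simp: v'_def inner_add_right)
  obtain \<tau> where \<tau>: "\<tau> \<in> maxface P d" "\<tau> \<in> maxface P w" using d(1) by blast
  have vs: "w \<bullet> v \<le> s" using s(1) maxfaceD(2)[OF v(3)] by force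
  have ts: "s < w \<bullet> \<tau>" using s(2) maxfaceD(2)[OF \<tau>(2)] by force
  define t where "t = (s - w \<bullet> v) / (w \<bullet> \<tau> - w \<bullet> v)"
  have t: "0 \<le> t" "t < 1" using vs ts by (auto simp: t_def)
  have tw: "t * (w \<bullet> \<tau> - w \<bullet> v) = s - w \<bullet> v" using vs ts by (simp add: t_def)
  have cd: "convex (maxface P d)" using maxface_face[OF cP] by (rule face_of_imp_convex)
  have level: "w \<bullet> ((1 - t) *\<^sub>R a + t *\<^sub>R \<tau>) = s" if "w \<bullet> a = w \<bullet> v" for a
    using that tw by (simp add: inner_add_right algebra_simps)
  show thesis
  proof (rule that)
    show "(1 - t) *\<^sub>R v + t *\<^sub>R \<tau> \<in> maxface P d" "(1 - t) *\<^sub>R v' + t *\<^sub>R \<tau> \<in> maxface P d"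
      using cd v(2) v'(1) \<tau>(1) t unfolding convex_alt by auto
    show "(1 - t) *\<^sub>R v + t *\<^sub>R \<tau> \<noteq> (1 - t) *\<^sub>R v' + t *\<^sub>R \<tau>" using t v'(3) by simp
  qed (use level v'(2) in auto)
qed

text \<open>The face where \<open>c\<close> is maximal is the hull of its lattice points, so two
  points in it require two of these. The sign in \<open>L\<close> is due to
  \<open>exposed_hull\<close> being about minima.\<close>

lemma two_lattice_maximizers:
  fixes S :: "(real^3) set"
  assumes S: "S = convex hull {x \<in> S. lattice_pt x}" "finite {x \<in> S. lattice_pt x}"
    and y: "y \<in> maxface S c" "y' \<in> maxface S c" "y \<noteq> y'"
  obtains a a' where "a \<in> maxface S c" "a' \<in> maxface S c" "lattice_pt a" "lattice_pt a'" "a \<noteq> a'"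
proof -
  define L where "L = {x \<in> {x \<in> S. lattice_pt x}. - c \<bullet> x = - c \<bullet> y}"
  have hull: "z \<in> convex hull L" if z: "z \<in> maxface S c" for z
  proof -
    have "z \<in> convex hull {x \<in> S. lattice_pt x}" using maxfaceD(1)[OF z] S(1) by simp
    then have "z \<in> convex hull {x \<in> {x \<in> S. lattice_pt x}. - c \<bullet> x = - c \<bullet> z}"
      by (rule exposed_hull[OF S(2)]) (use maxfaceD(2)[OF z] in simp)
    moreover have "c \<bullet> z = c \<bullet> y" using maxface_eq[OF z y(1)] .
    ultimately show ?thesis by (simp add: L_def)
  qed
  have "\<exists>a\<in>L. \<exists>a'\<in>L. a \<noteq> a'"
  proof (rule ccontr)
    assume "\<not> ?thesis"
    then obtain a where "L \<subseteq> {a}" by blast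
    then have "convex hull L \<subseteq> {a}" by (metis convex_hull_singleton hull_mono)
    then show False using hull[OF y(1)] hull[OF y(2)] y(3) by blast
  qed
  moreover have "a \<in> maxface S c" if "a \<in> L" for a
    using that maxface_eqI[OF y(1), of a] by (auto simp: L_def)
  ultimately show thesis using that by (auto simp: L_def)
qed

section \<open>Integral heights and coordinates\<close>

lemma prismlike_unit_normal:
  assumes P: "smooth_polytope3 P" "P \<noteq> {}" and w: "prismlike P w"
  obtains w' where "prismlike P w'" "unit_normal w'"
proof -
  note PD = smooth_polytope3D[OF P(1)]
  have cP: "convex P" "compact P" using PD(1) by (simp_all add: polytope_imp_convex polytope_imp_compact)
  obtain v where v: "v extreme_point_of P" "v \<in> maxface P (- w)"
    using face_extreme_point[OF PD(1) maxface_face[OF cP(1)] maxface_nonempty[OF cP(2) P(2)]] by blast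
  obtain U n where U: "dual_basis U n" "\<forall>u\<in>U. v + u \<in> P" "\<forall>u\<in>U. \<forall>x\<in>P. 0 \<le> n u \<bullet> (x - v)"
    by (rule smooth_vertex[OF P(1) v(1)])
  obtain u3 where u3: "u3 \<in> U" "w \<bullet> u3 > 0" "\<forall>u'\<in>U - {u3}. w \<bullet> u' = 0"
    by (rule bottom_vertex[OF w v(2) U])
  \<comment> \<open>This factor turns \<open>w\<close> into the dual basis vector
    \<open>n u3\<close>, which is integral on the lattice and 1 at \<open>u3\<close>.\<close>
  define k where "k = 1 / (w \<bullet> u3)"
  have k: "k > 0" "k * (w \<bullet> u3) = 1" using u3(2) by (auto simp: k_def)
  have "k *\<^sub>R w \<bullet> x = n u3 \<bullet> x" for x
  proof -
    have "w \<bullet> x = (n u3 \<bullet> x) * (w \<bullet> u3)"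
      unfolding dual_basis_inner[OF U(1), of w x]
      by (rule sum_single[OF dual_basisD(1)[OF U(1)] u3(1)]) (use u3(3) in simp)
    then show ?thesis using k by simp
  qed
  then have "unit_normal (k *\<^sub>R w)" unfolding unit_normal_def
    using dual_basisD(3,4,6)[OF U(1)] u3(1) by (metis (full_types))
  then show thesis using that prismlike_scale[OF w k(1)] by blast
qed

lemma prismlike_heights:
  assumes P: "smooth_polytope3 P" "P \<noteq> {}" and w: "prismlike P w" "unit_normal w"
  obtains a b where "a \<in> P" "b \<in> P" "w \<bullet> a < w \<bullet> b" "\<forall>x\<in>P. w \<bullet> a \<le> w \<bullet> x \<and> w \<bullet> x \<le> w \<bullet> b"
    "w \<bullet> a \<in> \<int>" "w \<bullet> b \<in> \<int>"
proof -
  note PD = smooth_polytope3D[OF P(1)]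
  have cP: "convex P" "compact P" using PD(1) by (simp_all add: polytope_imp_convex polytope_imp_compact)
  obtain a where a: "a extreme_point_of P" "a \<in> maxface P (- w)"
    using face_extreme_point[OF PD(1) maxface_face[OF cP(1)] maxface_nonempty[OF cP(2) P(2)]] by blast
  obtain b where b: "b extreme_point_of P" "b \<in> maxface P w"
    using face_extreme_point[OF PD(1) maxface_face[OF cP(1)] maxface_nonempty[OF cP(2) P(2)]] by blast
  obtain U n where U: "dual_basis U n" "\<forall>u\<in>U. a + u \<in> P" "\<forall>u\<in>U. \<forall>x\<in>P. 0 \<le> n u \<bullet> (x - a)"
    by (rule smooth_vertex[OF P(1) a(1)])
  obtain u3 where u3: "u3 \<in> U" "w \<bullet> u3 > 0" "\<forall>u'\<in>U - {u3}. w \<bullet> u' = 0"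
    by (rule bottom_vertex[OF w(1) a(2) U])
  have "a + u3 \<in> P" using U(2) u3(1) by blast
  then have "w \<bullet> a + w \<bullet> u3 \<le> w \<bullet> b" using maxfaceD(2)[OF b(2), of "a + u3"] by (simp add: inner_add_right)
  then have "w \<bullet> a < w \<bullet> b" using u3(2) by linarith
  moreover have "\<forall>x\<in>P. w \<bullet> a \<le> w \<bullet> x \<and> w \<bullet> x \<le> w \<bullet> b"
    using maxfaceD(2)[OF a(2)] maxfaceD(2)[OF b(2)] by force
  moreover have "w \<bullet> a \<in> \<int>" "w \<bullet> b \<in> \<int>" using PD(3) a(1) b(1) w(2) by (auto simp: unit_normal_def)
  ultimately show thesis using that maxfaceD(1)[OF a(2)] maxfaceD(1)[OF b(2)] by blast
qed

text \<open>\<open>w\<close> is itself a dual basis vector at a bottom vertex; the two others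
  complete it to integral coordinates of space. Since \<open>w\<close> is common to both polytopes,
  one system identifies the slices of either at integral heights with planar sets.\<close>

lemma unit_normal_coordinates:
  assumes P: "smooth_polytope3 P" "P \<noteq> {}" and w: "prismlike P w" "unit_normal w"
  obtains n1 n2 where "\<forall>x y. n1 \<bullet> x = n1 \<bullet> y \<and> n2 \<bullet> x = n2 \<bullet> y \<and> w \<bullet> x = w \<bullet> y \<longrightarrow> x = y"
    "\<forall>x. lattice_pt x \<longleftrightarrow> n1 \<bullet> x \<in> \<int> \<and> n2 \<bullet> x \<in> \<int> \<and> w \<bullet> x \<in> \<int>"
proof -
  note PD = smooth_polytope3D[OF P(1)]
  have cP: "convex P" "compact P" using PD(1) by (simp_all add: polytope_imp_convex polytope_imp_compact)
  obtain a where a: "a extreme_point_of P" "a \<in> maxface P (- w)"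
    using face_extreme_point[OF PD(1) maxface_face[OF cP(1)] maxface_nonempty[OF cP(2) P(2)]] by blast
  obtain U n where U: "dual_basis U n" "\<forall>u\<in>U. a + u \<in> P" "\<forall>u\<in>U. \<forall>x\<in>P. 0 \<le> n u \<bullet> (x - a)"
    by (rule smooth_vertex[OF P(1) a(1)])
  obtain u3 where u3: "u3 \<in> U" "w \<bullet> u3 > 0" "\<forall>u'\<in>U - {u3}. w \<bullet> u' = 0"
    by (rule bottom_vertex[OF w(1) a(2) U])
  have one: "w \<bullet> u3 = 1" by (rule bottom_unit[OF w(2) U(1) u3])
  have wx: "w \<bullet> x = n u3 \<bullet> x" for x
  proof -
    have "w \<bullet> x = (n u3 \<bullet> x) * (w \<bullet> u3)"
      unfolding dual_basis_inner[OF U(1), of w x]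
      by (rule sum_single[OF dual_basisD(1)[OF U(1)] u3(1)]) (use u3(3) in simp)
    then show ?thesis by (simp add: one)
  qed
  have "card (U - {u3}) = 2" using dual_basisD(1,2)[OF U(1)] u3(1) by simp
  then obtain u1 u2 where u12: "U - {u3} = {u1, u2}" "u1 \<noteq> u2" by (auto simp: card_2_iff)
  then have U3: "U = {u1, u2, u3}" "u1 \<noteq> u3" "u2 \<noteq> u3" "u1 \<in> U" "u2 \<in> U" using u3(1) by blast+
  have exp: "x = (n u1 \<bullet> x) *\<^sub>R u1 + (n u2 \<bullet> x) *\<^sub>R u2 + (w \<bullet> x) *\<^sub>R u3" for x
  proof -
    have "(\<Sum>u\<in>U. (n u \<bullet> x) *\<^sub>R u) = (n u1 \<bullet> x) *\<^sub>R u1 + (n u2 \<bullet> x) *\<^sub>R u2 + (w \<bullet> x) *\<^sub>R u3"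
      unfolding U3(1) using U3(2,3) u12(2) by (simp add: wx)
    then show ?thesis using dual_basisD(5)[OF U(1), of x] by simp
  qed
  show thesis
  proof (rule that[of "n u1" "n u2"])
    show "\<forall>x y. n u1 \<bullet> x = n u1 \<bullet> y \<and> n u2 \<bullet> x = n u2 \<bullet> y \<and> w \<bullet> x = w \<bullet> y \<longrightarrow> x = y"
      using exp by metis
    show "\<forall>x. lattice_pt x \<longleftrightarrow> n u1 \<bullet> x \<in> \<int> \<and> n u2 \<bullet> x \<in> \<int> \<and> w \<bullet> x \<in> \<int>"
    proof (intro allI iffI)
      fix x assume "lattice_pt x"
      then show "n u1 \<bullet> x \<in> \<int> \<and> n u2 \<bullet> x \<in> \<int> \<and> w \<bullet> x \<in> \<int>"
        unfolding wx using dual_basisD(6)[OF U(1)] U3(4,5) u3(1) by blast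
    next
      fix x assume "n u1 \<bullet> x \<in> \<int> \<and> n u2 \<bullet> x \<in> \<int> \<and> w \<bullet> x \<in> \<int>"
      then show "lattice_pt x" using dual_basisD(3)[OF U(1)] U3(4,5) u3(1)
        by (subst exp) (intro lattice_pt_add lattice_pt_scale; blast)
    qed
  qed
qed

lemma smooth_prismlike_IDP:
  assumes P: "smooth_polytope3 P" "P \<noteq> {}" and P': "smooth_polytope3 P'" "P' \<noteq> {}"
    and fan: "normal_fan P = normal_fan P'" and w: "prismlike P w" "unit_normal w"
  shows "IDP_pair P P'"
  unfolding IDP_pair_def
proof (intro allI impI, elim conjE)
  fix z assume z: "lattice_pt z" "z \<in> {x + y |x y. x \<in> P \<and> y \<in> P'}"
  note PD = smooth_polytope3D[OF P(1)] and PD' = smooth_polytope3D[OF P'(1)]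
  have cP: "convex P" "convex P'" using PD(1) PD'(1) by (simp_all add: polytope_imp_convex)
  have w': "prismlike P' w" by (rule prismlike_normal_fan[OF fan PD(1) P(2) PD'(1) P'(2) w(1)])
  obtain x y where xy: "x \<in> P" "y \<in> P'" "z = x + y" using z by blast
  obtain a b where ab: "a \<in> P" "b \<in> P" "w \<bullet> a < w \<bullet> b" "\<forall>x\<in>P. w \<bullet> a \<le> w \<bullet> x \<and> w \<bullet> x \<le> w \<bullet> b"
    "w \<bullet> a \<in> \<int>" "w \<bullet> b \<in> \<int>" by (rule prismlike_heights[OF P w])
  obtain a' b' where ab': "a' \<in> P'" "b' \<in> P'" "w \<bullet> a' < w \<bullet> b'"
    "\<forall>x\<in>P'. w \<bullet> a' \<le> w \<bullet> x \<and> w \<bullet> x \<le> w \<bullet> b'"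
    "w \<bullet> a' \<in> \<int>" "w \<bullet> b' \<in> \<int>" by (rule prismlike_heights[OF P' w' w(2)])
  \<comment> \<open>The least admissible height of the first summand: not below the bottom of
    \<open>P\<close>, and leaving no more than the top height of \<open>P'\<close> to the second.
    Extreme heights are integral, hence so is \<open>s\<close>.\<close>
  define s where "s = max (w \<bullet> a) (w \<bullet> z - w \<bullet> b')"
  define t where "t = w \<bullet> z - s"
  have "w \<bullet> z \<in> \<int>" using w(2) z(1) by (simp add: unit_normal_def)
  then have st_int: "s \<in> \<int>" "t \<in> \<int>" using ab(5) ab'(6) by (auto simp: s_def t_def max_def)
  have wz: "w \<bullet> z = w \<bullet> x + w \<bullet> y" unfolding xy(3) by (simp add: inner_add_right)
  have bounds: "w \<bullet> a \<le> w \<bullet> x" "w \<bullet> x \<le> w \<bullet> b" "w \<bullet> a' \<le> w \<bullet> y" "w \<bullet> y \<le> w \<bullet> b'"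
    using ab(4) ab'(4) xy(1,2) by blast+
  have s: "w \<bullet> a \<le> s" "s \<le> w \<bullet> b" and t: "w \<bullet> a' \<le> t" "t \<le> w \<bullet> b'"
    using bounds ab(3) ab'(3) unfolding s_def t_def wz by linarith+
  have xyst: "w \<bullet> (x + y) = s + t" using xy(3) by (simp add: t_def)
  obtain x1 y1 where xy1: "x1 \<in> P" "y1 \<in> P'" "w \<bullet> x1 = s" "w \<bullet> y1 = t" "x + y = x1 + y1"
    using minkowski_slice[OF fan PD(1) P(2) PD'(1) P'(2) w(1) ab(1,2) less_imp_neq[OF ab(3)] xy(1,2) xyst]
      s t ab(1,2) ab'(1,2) by blast
  define A where "A = P \<inter> {x. w \<bullet> x = s}"
  define B where "B = P' \<inter> {x. w \<bullet> x = t}"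
  note hullA = slice_lattice_hull[OF P(1) w st_int(1) A_def]
  note hullB = slice_lattice_hull[OF P'(1) w' w(2) st_int(2) B_def]
  obtain n1 n2 where inj: "\<forall>x y. n1 \<bullet> x = n1 \<bullet> y \<and> n2 \<bullet> x = n2 \<bullet> y \<and> w \<bullet> x = w \<bullet> y \<longrightarrow> x = y"
    and lat: "\<forall>x. lattice_pt x \<longleftrightarrow> n1 \<bullet> x \<in> \<int> \<and> n2 \<bullet> x \<in> \<int> \<and> w \<bullet> x \<in> \<int>"
    by (rule unit_normal_coordinates[OF P w])
  define \<pi> where "\<pi> x = (n1 \<bullet> x, n2 \<bullet> x)" for x
  have lin: "linear \<pi>" unfolding \<pi>_def by (rule linearI) (auto simp: inner_add_right)
  have \<pi>add: "\<pi> (x + y) = \<pi> x + \<pi> y" for x y by (simp add: \<pi>_def inner_add_right)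
  have \<pi>int: "integral2 (\<pi> x) \<longleftrightarrow> lattice_pt x" if "w \<bullet> x \<in> \<int>" for x
    using lat that by (simp add: \<pi>_def integral2_def)
  have \<pi>inj: "x = y" if "\<pi> x = \<pi> y" "w \<bullet> x = w \<bullet> y" for x y
    using inj that unfolding \<pi>_def by blast
  have img: "{x \<in> \<pi> ` R. integral2 x} = \<pi> ` {x \<in> R. lattice_pt x}" if "\<forall>x\<in>R. w \<bullet> x \<in> \<int>" for R
    using \<pi>int that by auto
  have imgA: "{x \<in> \<pi> ` A. integral2 x} = \<pi> ` {x \<in> A. lattice_pt x}"
    and imgB: "{x \<in> \<pi> ` B. integral2 x} = \<pi> ` {x \<in> B. lattice_pt x}"
    by (rule img; use st_int in \<open>simp add: A_def B_def\<close>)+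
  have hA: "\<pi> ` A = convex hull {x \<in> \<pi> ` A. integral2 x}"
    unfolding imgA convex_hull_linear_image[OF lin, symmetric] using hullA(1) by (rule arg_cong)
  have hB: "\<pi> ` B = convex hull {x \<in> \<pi> ` B. integral2 x}" "finite {x \<in> \<pi> ` B. integral2 x}"
    unfolding imgB convex_hull_linear_image[OF lin, symmetric] using hullB(1) by (rule arg_cong) (use hullB(2) in simp)
  have edges: "\<exists>f f'. f \<in> \<pi> ` A \<and> f' \<in> \<pi> ` A \<and> integral2 f \<and> integral2 f' \<and> f \<noteq> f' \<and>
        (\<forall>x\<in>\<pi> ` A. e \<bullet> x \<le> e \<bullet> f) \<and> (\<forall>x\<in>\<pi> ` A. e \<bullet> x \<le> e \<bullet> f')"
    if pq: "p \<in> \<pi> ` B" "q \<in> \<pi> ` B" "p \<noteq> q" and max: "\<And>x. x \<in> \<pi> ` B \<Longrightarrow> e \<bullet> x \<le> e \<bullet> p"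
      "\<And>x. x \<in> \<pi> ` B \<Longrightarrow> e \<bullet> x \<le> e \<bullet> q" for e p q
  proof -
    define c where "c = fst e *\<^sub>R n1 + snd e *\<^sub>R n2"
    have c: "e \<bullet> \<pi> x = c \<bullet> x" for x by (simp add: c_def \<pi>_def inner_prod_def inner_add_left)
    obtain g h where gh: "g \<in> B" "h \<in> B" "p = \<pi> g" "q = \<pi> h" using pq by blast
    have gmax: "c \<bullet> x \<le> c \<bullet> g" "c \<bullet> x \<le> c \<bullet> h" if "x \<in> B" for x
      using max[of "\<pi> x"] that gh by (auto simp: c)
    \<comment> \<open>Within a slice \<open>d\<close> and \<open>c\<close> differ by a constant, so
      the edge through \<open>g\<close> and \<open>h\<close> lies in the face of \<open>P'\<close>
      belonging to \<open>d\<close>, while the face of \<open>P\<close> belonging to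
      \<open>d\<close> joins bottom and top.\<close>
    obtain k where k: "maxface P (c + k *\<^sub>R w) \<inter> maxface P w \<noteq> {}"
      "maxface P (c + k *\<^sub>R w) \<inter> maxface P (- w) \<noteq> {}"
      by (rule prismlike_balance[OF PD(1) P(2) w(1) ab(1,2) less_imp_neq[OF ab(3)]])
    define d where "d = c + k *\<^sub>R w"
    note k = k[folded d_def]
    have dx: "d \<bullet> x = c \<bullet> x + k * (w \<bullet> x)" for x by (simp add: d_def inner_add_left)
    obtain f1 f2 where f: "f1 \<in> maxface P' d" "f1 \<in> maxface P' w" "f2 \<in> maxface P' d" "f2 \<in> maxface P' (- w)"
      using normal_fan_maxface_Int[OF fan cP(1) k(1)] normal_fan_maxface_Int[OF fan cP(1) k(2)] by blast
    have "w \<bullet> f2 \<le> t" "t \<le> w \<bullet> f1"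
      using maxfaceD(2)[OF f(4) ab'(1)] maxfaceD(2)[OF f(2) ab'(2)] t by simp_all
    then obtain m where m: "m \<in> maxface P' d" "w \<bullet> m = t"
      using convex_level_point[OF face_of_imp_convex[OF maxface_face[OF cP(2)]] f(3,1)] by blast
    have mB: "m \<in> B" using maxfaceD(1)[OF m(1)] m(2) by (simp add: B_def)
    have ghB: "g \<in> P'" "h \<in> P'" "w \<bullet> g = t" "w \<bullet> h = t" using gh by (auto simp: B_def)
    have gd: "g \<in> maxface P' d" "h \<in> maxface P' d"
      using maxface_eqI[OF m(1) ghB(1)] maxface_eqI[OF m(1) ghB(2)] gmax[OF mB] ghB m(2) by (simp_all add: dx)
    have gne: "g \<noteq> h" "w \<bullet> g = w \<bullet> h" using gh pq(3) ghB by auto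
    \<comment> \<open>\<open>slice_edge\<close> needs a height strictly below the top; at the top
      height it is applied to \<open>- w\<close>, which exchanges top and bottom.\<close>
    have "\<exists>y y'. y \<in> maxface P d \<and> y' \<in> maxface P d \<and> y \<noteq> y' \<and> w \<bullet> y = s \<and> w \<bullet> y' = s"
    proof (cases "s < w \<bullet> b")
      case True
      have lo: "\<exists>a\<in>P. w \<bullet> a \<le> s" using s(1) ab(1) by blast
      have hi: "\<exists>b\<in>P. s < w \<bullet> b" using True ab(2) by blast
      show ?thesis
        using slice_edge[OF fan P(1) PD'(1) P'(2) w(1) k gd gne lo hi] by blast
    next
      case False
      have gne': "- w \<bullet> g = - w \<bullet> h" using gne(2) by simp
      have k': "maxface P d \<inter> maxface P (- (- w)) \<noteq> {}" using k(1) by simp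
      have lo: "\<exists>a\<in>P. - w \<bullet> a \<le> - s" using s(2) ab(2) by auto
      have hi: "\<exists>b\<in>P. - s < - w \<bullet> b" using False ab(1,3) by (intro bexI[of _ a]) auto
      obtain y y' where "y \<in> maxface P d" "y' \<in> maxface P d" "y \<noteq> y'" "- w \<bullet> y = - s" "- w \<bullet> y' = - s"
        using slice_edge[OF fan P(1) PD'(1) P'(2) prismlike_uminus[OF w(1)] k(2) k' gd gne(1) gne' lo hi] by blast
      then show ?thesis by auto
    qed
    then obtain y y' where y: "y \<in> maxface P d" "y' \<in> maxface P d" "y \<noteq> y'" "w \<bullet> y = s" "w \<bullet> y' = s" by blast
    have mA: "y \<in> maxface A c" if y: "y \<in> maxface P d" "w \<bullet> y = s" for y
    proof -
      have "c \<bullet> x \<le> c \<bullet> y" if "x \<in> A" for x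
        using maxfaceD(2)[OF y(1), of x] that y(2) by (simp add: A_def dx)
      moreover have "y \<in> A" using maxfaceD(1)[OF y(1)] y(2) by (simp add: A_def)
      ultimately show ?thesis by (simp add: maxface_def)
    qed
    obtain f f' where ff: "f \<in> maxface A c" "f' \<in> maxface A c" "lattice_pt f" "lattice_pt f'" "f \<noteq> f'"
      by (rule two_lattice_maximizers[OF hullA mA[OF y(1,4)] mA[OF y(2,5)] y(3)])
    have fA: "f \<in> A" "f' \<in> A" "w \<bullet> f = s" "w \<bullet> f' = s" using ff(1,2) by (auto simp: maxface_def A_def)
    show ?thesis
    proof (rule exI[of _ "\<pi> f"], rule exI[of _ "\<pi> f'"], intro conjI)
      show "\<pi> f \<noteq> \<pi> f'" using \<pi>inj[of f f'] fA ff(5) by auto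
      show "integral2 (\<pi> f)" "integral2 (\<pi> f')" using \<pi>int fA ff st_int by simp_all
      show "\<forall>x\<in>\<pi> ` A. e \<bullet> x \<le> e \<bullet> \<pi> f" "\<forall>x\<in>\<pi> ` A. e \<bullet> x \<le> e \<bullet> \<pi> f'"
        using maxfaceD(2)[OF ff(1)] maxfaceD(2)[OF ff(2)] by (auto simp: c)
    qed (use fA in auto)
  qed
  have x1A: "\<pi> x1 \<in> \<pi> ` A" "\<pi> y1 \<in> \<pi> ` B" using xy1 by (auto simp: A_def B_def)
  have z1: "\<pi> x1 + \<pi> y1 = \<pi> z" using xy1(5) xy(3) by (simp flip: \<pi>add)
  have int1: "integral2 (\<pi> x1 + \<pi> y1)" unfolding z1 using \<pi>int \<open>w \<bullet> z \<in> \<int>\<close> z(1) by simp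
  have "\<exists>f g. f \<in> \<pi> ` A \<and> g \<in> \<pi> ` B \<and> integral2 f \<and> integral2 g \<and> f + g = \<pi> x1 + \<pi> y1"
  proof (rule polygon_pair_integral[OF hA hB _ x1A int1])
    fix e p q assume "p \<in> \<pi> ` B" "q \<in> \<pi> ` B" "p \<noteq> q"
      "\<And>x. x \<in> \<pi> ` B \<Longrightarrow> e \<bullet> x \<le> e \<bullet> p" "\<And>x. x \<in> \<pi> ` B \<Longrightarrow> e \<bullet> x \<le> e \<bullet> q"
    then show "\<exists>f f'. f \<in> \<pi> ` A \<and> f' \<in> \<pi> ` A \<and> integral2 f \<and> integral2 f' \<and> f \<noteq> f' \<and>
        (\<forall>x\<in>\<pi> ` A. e \<bullet> x \<le> e \<bullet> f) \<and> (\<forall>x\<in>\<pi> ` A. e \<bullet> x \<le> e \<bullet> f')"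
      by (rule edges)
  qed blast
  then obtain f g where fg: "f \<in> \<pi> ` A" "g \<in> \<pi> ` B" "integral2 f" "integral2 g" "f + g = \<pi> x1 + \<pi> y1"
    by blast
  then obtain x2 y2 where x2: "x2 \<in> A" "f = \<pi> x2" and y2: "y2 \<in> B" "g = \<pi> y2" by blast
  have h2: "w \<bullet> x2 = s" "w \<bullet> y2 = t" "x2 \<in> P" "y2 \<in> P'" using x2 y2 by (auto simp: A_def B_def)
  have "lattice_pt x2" "lattice_pt y2" using \<pi>int[of x2] \<pi>int[of y2] h2 fg x2 y2 st_int by auto
  moreover have "z = x2 + y2"
    by (rule \<pi>inj) (use fg(5) z1 x2 y2 h2 in \<open>simp_all add: \<pi>add inner_add_right t_def\<close>)
  ultimately show "\<exists>x y. x \<in> P \<and> y \<in> P' \<and> lattice_pt x \<and> lattice_pt y \<and> z = x + y" using h2 by blast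
qed

theorem theorem4p5:
  fixes P P' :: "(real^3) set"
  assumes "smooth_polytope3 P" and "prismatoid3 P"
      and "smooth_polytope3 P'" and "prismatoid3 P'"
      and "minkowski_equiv P P'"
  shows "IDP_pair P P'"
proof -
  note PD = smooth_polytope3D[OF assms(1)]
  have ne: "P \<noteq> {}" "P' \<noteq> {}" using PD(2) smooth_polytope3D(2)[OF assms(3)] by auto
  obtain w0 where "prismlike P w0" by (rule prismatoid_prismlike[OF PD(1,2) assms(2)])
  then obtain w where "prismlike P w" "unit_normal w" by (rule prismlike_unit_normal[OF assms(1) ne(1)])
  then show ?thesis
    using smooth_prismlike_IDP[OF assms(1) ne(1) assms(3) ne(2)] assms(5) by (simp add: minkowski_equiv_def)
qed

end
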